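(* Let $X$ be an oriented closed connected $C^\infty$-manifold of dimension $2m+1$, $m\in\mathbb{N}$, let $\mathbb{F}$ be a commutative field with involution $\bar{\ }$, let $\rho:\pi_1(X)\to \mathrm{GL}_n(\mathbb{F})$ be a representation, and let $\psi:\mathbb{F}^n\times\mathbb{F}^n\to\mathbb{F}$ be a hermitian or anti-hermitian $\rho$-invariant form. Suppose that for every $i$ the pairing $$H^i_\rho(X;\mathbb{F}^n)\times H^{2m+1-i}_\rho(X;\mathbb{F}^n)\to\mathbb{F},\qquad (x,y)\mapsto \psi_*\big((x\smile y)\cap[X]\big)$$ is non-degenerate. For each $0\le j\le m$ take an (ordered) basis $\mathbf{h}_j$ of $H^j_\rho(X;\mathbb{F}^n)$, and let $\mathbf{h}_j^{\rm dual}\subset H^{2m+1-j}_\rho(X;\mathbb{F}^n)$ be its dual basis with respect to this pairing. Then the refined torsion $$\tau^0_\rho\big(X,\{\mathbf{h}_0,\mathbf{h}_1,\dots,\mathbf{h}_m,\mathbf{h}_m^{\rm dual},\mathbf{h}_{m-1}^{\rm dual},\dots,\mathbf{h}_0^{\rm dual}\}\big)\in \mathbb{F}^\times/\langle N(\mathbb{F}),\det(\rho(\pi_1(X)))\rangle$$ is independent of the choice of the bases $\mathbf{h}_0,\dots,\mathbf{h}_m$.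
   Context: Forms: when the involution is non-trivial, "bilinear form" $\psi$ means sesquilinear form (linear in one variable and conjugate-linear in the other; bilinear if the involution is the identity); hermitian (resp. anti-hermitian) means $\psi(w,v)=\overline{\psi(v,w)}$ (resp. $-\overline{\psi(v,w)}$). $\rho$-invariant means $\psi(\rho(g)v,\rho(g)w)=\psi(v,w)$ for all $g\in\pi_1(X)$. Subgroups: $N(\mathbb{F})=\{y\bar y\mid y\in\mathbb{F}^\times\}$, $\det(\rho(\pi_1(X)))=\{\det\rho(g)\mid g\in\pi_1(X)\}$, and $\langle\ ,\ \rangle$ is the generated subgroup of $\mathbb{F}^\times$. Algebraic torsion: for bases $\mathbf{b},\mathbf{c}$ of a finite-dimensional space, $[\mathbf{b}/\mathbf{c}]$ is the determinant of the matrix $P$ with $b_i=\sum_j P_{(j,i)}c_j$. For a cochain complex $C^*=(0\to C^0\to\dots\to C^k\to0)$ of finite-dimensional $\mathbb{F}$-spaces with ordered bases $\mathbf{c}_i$ of $C^i$ and $\mathbf{h}_i$ of $H^i(C^* )$, choose bases $\mathbf{b}_i$ of $B^i=\mathrm{Im}(\delta^{i-1})$, lifts $\widetilde{\mathbf{b}}_{i+1}\subset C^i$ of $\mathbf{b}_{i+1}$ along $\delta^i$, and lifts $\widetilde{\mathbf{h}}_i\subset \mathrm{Ker}\,\delta^i$ of $\mathbf{h}_i$; then $$\tau(C^*,\mathbf{c},\mathbf{h})=\prod_{i=0}^k[(\mathbf{b}_i\cup\widetilde{\mathbf{h}}_i\cup\widetilde{\mathbf{b}}_{i+1})/\mathbf{c}_i]^{(-1)^{i+1}}\in\mathbb{F}^\times,$$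 which does not depend on the choices of $\mathbf{b}_i$ and the lifts. Refined torsion: give $X$ a finite CW structure (triangulation), let $\widetilde X$ be the universal cover, $C^*_\rho(X;\mathbb{F}^n)=\mathrm{Hom}_{\mathbb{Z}[\pi_1(X)]}(C_*(\widetilde X;\mathbb{Z}),\mathbb{F}^n)$ with cohomology $H^*_\rho(X;\mathbb{F}^n)$, and let $\mathbf{c}_X$ be the basis of $C^*_\rho$ dual to (lifted oriented ordered cells)$\otimes$(standard basis of $\mathbb{F}^n$). Fix an orientation of $\bigoplus_i H^i(X;\mathbb{R})$ and a positive basis $\mathbf{h}^{\mathbb{R}}=(\mathbf{h}^{\mathbb{R}}_0,\mathbf{h}^{\mathbb{R}}_1,\dots)$ of it; let $\mathbf{c}$ be the cellular basis of $C^*(X;\mathbb{R})$. Put $N(X)=\sum_{i=0}^{\dim X}\big(\sum_{j=0}^i\dim H^{\dim X-j}(X;\mathbb{R})\big)\big(\sum_{j=0}^i\dim C^{\dim X-j}(X;\mathbb{R})\big)\in\mathbb{Z}/2$ and $\tilde\tau=(-1)^{N(X)}\tau(C^*(X;\mathbb{R}),\mathbf{c},\mathbf{h}^{\mathbb{R}})$. Then $$\tau^0_\rho(X,\mathbf{h})=\mathrm{sign}(\tilde\tau)^n\cdot\tau(C^*_\rho(X;\mathbb{F}^n),\mathbf{c}_X,\mathbf{h})\in\mathbb{F}^\times/\det(\rho(\pi_1(X))).$$ In the claim all data other than the bases $\mathbf{h}_j$ (CW structure, lifts, order and orientation of cells, orientation of $\bigoplus_i H^i(X;\mathbb{R})$)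 are fixed, and the torsion is projected to the further quotient by $N(\mathbb{F})$. Pairing: $\psi_*$ denotes the map on coefficients induced by $\psi$, so that the cup product with coefficients $\mathbb{F}^n\otimes\mathbb{F}^n$ evaluated on the fundamental class $[X]$ gives an element of $\mathbb{F}$. The dual basis is characterized by the pairing of the $a$-th element of $\mathbf{h}_j$ with the $b$-th element of $\mathbf{h}_j^{\rm dual}$ being $1$ if $a=b$ and $0$ otherwise. *)

theory Defs
  imports
    "HOL-Analysis.Analysis"
    "HOL-Homology.Homology"
    "HOL-Library.Function_Algebras"
    "Jordan_Normal_Form.Determinant"
begin

hide_type (open) Matrix.vec
hide_const (open) Determinant.det Matrix.vec Matrix.mat
no_notation Matrix.vec_index (infixl "$" 100)

section \<open>Linear algebra\<close>

text \<open>Vector spaces are subspaces of an ambient abelian group with scalar multiplication \<open>s\<close>.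
  Ordered bases are lists.\<close>

definition ordered_basis :: "('k::field \<Rightarrow> 'v::ab_group_add \<Rightarrow> 'v) \<Rightarrow> 'v set \<Rightarrow> 'v list \<Rightarrow> bool" where
  "ordered_basis s V bs \<longleftrightarrow>
     distinct bs \<and> \<not> module.dependent s (set bs) \<and> module.span s (set bs) = V"

text \<open>\<open>[b/c]\<close>: the determinant of the matrix whose \<open>i\<close>-th column holds the coordinates
  of \<open>b ! i\<close> with respect to \<open>c\<close>.\<close>

definition base_change_det :: "('k::field \<Rightarrow> 'v::ab_group_add \<Rightarrow> 'v) \<Rightarrow> 'v list \<Rightarrow> 'v list \<Rightarrow> 'k" where
  "base_change_det s bs cs =
     Determinant.det (Matrix.mat (length cs) (length cs)
       (\<lambda>(j, i). module.representation s (set cs) (bs ! i) (cs ! j)))"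

definition qclass :: "'v::ab_group_add set \<Rightarrow> 'v \<Rightarrow> 'v set" where
  "qclass B x = {x + b | b. b \<in> B}"

definition quotient_space :: "'v::ab_group_add set \<Rightarrow> 'v set \<Rightarrow> 'v set set" where
  "quotient_space Z B = qclass B ` Z"

text \<open>Ordered bases of \<open>Z / B\<close>: every class is a unique linear combination of the given classes;
  linear combinations of classes are formed on representatives.\<close>

definition quotient_basis ::
    "('k::field \<Rightarrow> 'v::ab_group_add \<Rightarrow> 'v) \<Rightarrow> 'v set \<Rightarrow> 'v set \<Rightarrow> 'v set list \<Rightarrow> bool" where
  "quotient_basis s Z B hs \<longleftrightarrow>
     (\<exists>xs. set xs \<subseteq> Z \<and> hs = map (qclass B) xs \<and>
        (\<forall>z\<in>Z. \<exists>!a. length a = length xs \<and>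
            qclass B z = qclass B (\<Sum>k<length xs. s (a ! k) (xs ! k))))"


section \<open>Cochain complexes and algebraic torsion\<close>

text \<open>A cochain complex is given by subspaces \<open>C i\<close> and maps \<open>\<delta> i\<close> from \<open>C i\<close> to \<open>C (i + 1)\<close>.\<close>

definition cocycles :: "(nat \<Rightarrow> 'v set) \<Rightarrow> (nat \<Rightarrow> 'v \<Rightarrow> 'v) \<Rightarrow> nat \<Rightarrow> 'v::ab_group_add set" where
  "cocycles C \<delta> i = {x \<in> C i. \<delta> i x = 0}"

definition coboundaries :: "(nat \<Rightarrow> 'v set) \<Rightarrow> (nat \<Rightarrow> 'v \<Rightarrow> 'v) \<Rightarrow> nat \<Rightarrow> 'v::ab_group_add set" where
  "coboundaries C \<delta> i = (case i of 0 \<Rightarrow> {0} | Suc j \<Rightarrow> \<delta> j ` C j)"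

definition cohomology_basis ::
    "('k::field \<Rightarrow> 'v::ab_group_add \<Rightarrow> 'v) \<Rightarrow> (nat \<Rightarrow> 'v set) \<Rightarrow> (nat \<Rightarrow> 'v \<Rightarrow> 'v) \<Rightarrow> nat \<Rightarrow> 'v set list \<Rightarrow> bool" where
  "cohomology_basis s C \<delta> i hs \<longleftrightarrow> quotient_basis s (cocycles C \<delta> i) (coboundaries C \<delta> i) hs"

text \<open>\<open>b i\<close> is a basis of the coboundaries of degree \<open>i\<close>, \<open>ht i\<close> lifts \<open>h i\<close> to cocycles, and
  \<open>bt (i + 1)\<close> lifts \<open>b (i + 1)\<close> along \<open>\<delta> i\<close>.  The torsion does not depend on these choices.\<close>

definition is_torsion ::
    "('k::field \<Rightarrow> 'v::ab_group_add \<Rightarrow> 'v) \<Rightarrow> nat \<Rightarrow> (nat \<Rightarrow> 'v set) \<Rightarrow> (nat \<Rightarrow> 'v \<Rightarrow> 'v) \<Rightarrow>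
     (nat \<Rightarrow> 'v list) \<Rightarrow> (nat \<Rightarrow> 'v set list) \<Rightarrow> 'k \<Rightarrow> bool" where
  "is_torsion s k C \<delta> c h t \<longleftrightarrow>
     (\<exists>b bt ht.
        (\<forall>i\<le>Suc k. ordered_basis s (coboundaries C \<delta> i) (b i)) \<and>
        (\<forall>i\<le>k. set (bt (Suc i)) \<subseteq> C i \<and> map (\<delta> i) (bt (Suc i)) = b (Suc i)) \<and>
        (\<forall>i\<le>k. length (ht i) = length (h i) \<and> (\<forall>a<length (h i). ht i ! a \<in> h i ! a)) \<and>
        t = (\<Prod>i\<le>k. base_change_det s (b i @ ht i @ bt (Suc i)) (c i) powi ((-1) ^ Suc i)))"

definition torsion ::
    "('k::field \<Rightarrow> 'v::ab_group_add \<Rightarrow> 'v) \<Rightarrow> nat \<Rightarrow> (nat \<Rightarrow> 'v set) \<Rightarrow> (nat \<Rightarrow> 'v \<Rightarrow> 'v) \<Rightarrow>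
     (nat \<Rightarrow> 'v list) \<Rightarrow> (nat \<Rightarrow> 'v set list) \<Rightarrow> 'k" where
  "torsion s k C \<delta> c h = (THE t. is_torsion s k C \<delta> c h t)"


section \<open>Fields with involution, forms, groups\<close>

definition field_involution :: "('f::field \<Rightarrow> 'f) \<Rightarrow> bool" where
  "field_involution \<iota> \<longleftrightarrow>
     (\<forall>x y. \<iota> (x + y) = \<iota> x + \<iota> y) \<and> (\<forall>x y. \<iota> (x * y) = \<iota> x * \<iota> y) \<and>
     \<iota> 1 = 1 \<and> (\<forall>x. \<iota> (\<iota> x) = x)"

text \<open>Either variable may be the linear one.\<close>

definition sesquilinear_form :: "('f::field \<Rightarrow> 'f) \<Rightarrow> ('f ^ 'n \<Rightarrow> 'f ^ 'n \<Rightarrow> 'f) \<Rightarrow> bool" where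
  "sesquilinear_form \<iota> \<psi> \<longleftrightarrow>
     (\<forall>u v w. \<psi> (u + v) w = \<psi> u w + \<psi> v w) \<and> (\<forall>u v w. \<psi> u (v + w) = \<psi> u v + \<psi> u w) \<and>
     ((\<forall>a v w. \<psi> (a *s v) w = a * \<psi> v w \<and> \<psi> v (a *s w) = \<iota> a * \<psi> v w) \<or>
      (\<forall>a v w. \<psi> (a *s v) w = \<iota> a * \<psi> v w \<and> \<psi> v (a *s w) = a * \<psi> v w))"

definition hermitian :: "('f::field \<Rightarrow> 'f) \<Rightarrow> ('f ^ 'n \<Rightarrow> 'f ^ 'n \<Rightarrow> 'f) \<Rightarrow> bool" where
  "hermitian \<iota> \<psi> \<longleftrightarrow> (\<forall>v w. \<psi> w v = \<iota> (\<psi> v w))"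

definition antihermitian :: "('f::field \<Rightarrow> 'f) \<Rightarrow> ('f ^ 'n \<Rightarrow> 'f ^ 'n \<Rightarrow> 'f) \<Rightarrow> bool" where
  "antihermitian \<iota> \<psi> \<longleftrightarrow> (\<forall>v w. \<psi> w v = - \<iota> (\<psi> v w))"

definition GL :: "('f::field ^ 'n ^ 'n) monoid" where
  "GL = \<lparr>carrier = {A. invertible A}, monoid.mult = (**), one = Finite_Cartesian_Product.mat 1\<rparr>"

definition field_units :: "'f::field monoid" where
  "field_units = \<lparr>carrier = {x. x \<noteq> 0}, monoid.mult = (*), one = 1\<rparr>"

definition norm_set :: "('f::field \<Rightarrow> 'f) \<Rightarrow> 'f set" where
  "norm_set \<iota> = {y * \<iota> y | y. y \<noteq> 0}"

text \<open>The vector space operations on the quotients \<open>Z / B\<close> and \<open>Z' / B'\<close> are formed on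
  representatives; sesquilinearity is part of being a non-degenerate pairing.\<close>

definition sesquilinear_pairing ::
    "('f::field \<Rightarrow> 'v::ab_group_add \<Rightarrow> 'v) \<Rightarrow> ('f \<Rightarrow> 'f) \<Rightarrow> 'v set \<Rightarrow> 'v set \<Rightarrow> 'v set \<Rightarrow> 'v set \<Rightarrow>
     ('v set \<Rightarrow> 'v set \<Rightarrow> 'f) \<Rightarrow> bool" where
  "sesquilinear_pairing s \<iota> Z B Z' B' P \<longleftrightarrow>
     (\<forall>x\<in>Z. \<forall>x'\<in>Z. \<forall>y\<in>Z'. P (qclass B (x + x')) (qclass B' y) =
         P (qclass B x) (qclass B' y) + P (qclass B x') (qclass B' y)) \<and>
     (\<forall>x\<in>Z. \<forall>y\<in>Z'. \<forall>y'\<in>Z'. P (qclass B x) (qclass B' (y + y')) =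
         P (qclass B x) (qclass B' y) + P (qclass B x) (qclass B' y')) \<and>
     ((\<forall>a. \<forall>x\<in>Z. \<forall>y\<in>Z'.
         P (qclass B (s a x)) (qclass B' y) = a * P (qclass B x) (qclass B' y) \<and>
         P (qclass B x) (qclass B' (s a y)) = \<iota> a * P (qclass B x) (qclass B' y)) \<or>
      (\<forall>a. \<forall>x\<in>Z. \<forall>y\<in>Z'.
         P (qclass B (s a x)) (qclass B' y) = \<iota> a * P (qclass B x) (qclass B' y) \<and>
         P (qclass B x) (qclass B' (s a y)) = a * P (qclass B x) (qclass B' y)))"

definition nondegenerate_pairing ::
    "('f::field \<Rightarrow> 'v::ab_group_add \<Rightarrow> 'v) \<Rightarrow> ('f \<Rightarrow> 'f) \<Rightarrow> 'v set \<Rightarrow> 'v set \<Rightarrow> 'v set \<Rightarrow> 'v set \<Rightarrow>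
     ('v set \<Rightarrow> 'v set \<Rightarrow> 'f) \<Rightarrow> bool" where
  "nondegenerate_pairing s \<iota> Z B Z' B' P \<longleftrightarrow>
     sesquilinear_pairing s \<iota> Z B Z' B' P \<and>
     (\<forall>H\<in>quotient_space Z B. (\<forall>K\<in>quotient_space Z' B'. P H K = 0) \<longrightarrow> H = qclass B 0) \<and>
     (\<forall>K\<in>quotient_space Z' B'. (\<forall>H\<in>quotient_space Z B. P H K = 0) \<longrightarrow> K = qclass B' 0)"


section \<open>Closed oriented smooth manifolds\<close>

primrec Ck_on :: "nat \<Rightarrow> ('e::euclidean_space \<Rightarrow> 'e) \<Rightarrow> 'e set \<Rightarrow> bool" where
  "Ck_on 0 f S \<longleftrightarrow> continuous_on S f"
| "Ck_on (Suc k) f S \<longleftrightarrow>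
     f differentiable_on S \<and> (\<forall>v. Ck_on k (\<lambda>x. frechet_derivative f (at x) v) S)"

definition smooth_on :: "('e::euclidean_space \<Rightarrow> 'e) \<Rightarrow> 'e set \<Rightarrow> bool" where
  "smooth_on f S \<longleftrightarrow> (\<forall>k. Ck_on k f S)"

definition smooth_manifold ::
    "'a::topological_space set \<Rightarrow> ('a set \<times> ('a \<Rightarrow> 'e::euclidean_space)) set \<Rightarrow> bool" where
  "smooth_manifold X A \<longleftrightarrow>
     Hausdorff_space (top_of_set X) \<and> second_countable (top_of_set X) \<and>
     (\<Union>(U, \<phi>)\<in>A. U) = X \<and>
     (\<forall>(U, \<phi>)\<in>A. openin (top_of_set X) U \<and> open (\<phi> ` U) \<and> (\<exists>\<phi>'. homeomorphism U (\<phi> ` U) \<phi> \<phi>')) \<and>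
     (\<forall>(U, \<phi>)\<in>A. \<forall>(V, \<eta>)\<in>A. smooth_on (\<eta> \<circ> inv_into U \<phi>) (\<phi> ` (U \<inter> V)))"

text \<open>An orientation of a \<open>d\<close>-manifold: a locally consistent choice of generators of the local
  homology groups.\<close>

definition manifold_orientation ::
    "nat \<Rightarrow> 'a::topological_space set \<Rightarrow> ('a \<Rightarrow> 'a chain set) \<Rightarrow> bool" where
  "manifold_orientation d X \<mu> \<longleftrightarrow>
     (\<forall>x\<in>X. \<mu> x \<in> carrier (relative_homology_group (int d) (top_of_set X) (X - {x})) \<and>
        generate (relative_homology_group (int d) (top_of_set X) (X - {x})) {\<mu> x} =
          carrier (relative_homology_group (int d) (top_of_set X) (X - {x}))) \<and>
     (\<forall>x\<in>X. \<exists>U \<alpha>. openin (top_of_set X) U \<and> x \<in> U \<and>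
        \<alpha> \<in> carrier (relative_homology_group (int d) (top_of_set X) (X - U)) \<and>
        (\<forall>y\<in>U. hom_induced (int d) (top_of_set X) (X - U) (top_of_set X) (X - {y}) id \<alpha> = \<mu> y))"

definition fundamental_class ::
    "nat \<Rightarrow> 'a::topological_space set \<Rightarrow> ('a \<Rightarrow> 'a chain set) \<Rightarrow> 'a chain set \<Rightarrow> bool" where
  "fundamental_class d X \<mu> \<zeta> \<longleftrightarrow>
     \<zeta> \<in> carrier (homology_group (int d) (top_of_set X)) \<and>
     (\<forall>x\<in>X. hom_induced (int d) (top_of_set X) {} (top_of_set X) (X - {x}) id \<zeta> = \<mu> x)"


section \<open>Fundamental group and universal cover\<close>

definition loop_class :: "'a::topological_space set \<Rightarrow> (real \<Rightarrow> 'a) \<Rightarrow> (real \<Rightarrow> 'a) set" where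
  "loop_class X p = {q. homotopic_paths X p q}"

definition pi1 :: "'a::topological_space set \<Rightarrow> 'a \<Rightarrow> (real \<Rightarrow> 'a) set monoid" where
  "pi1 X x =
     \<lparr>carrier = {loop_class X p | p. path p \<and> path_image p \<subseteq> X \<and> pathstart p = x \<and> pathfinish p = x},
      monoid.mult = (\<lambda>g h. \<Union>p\<in>g. \<Union>q\<in>h. loop_class X (p +++ q)),
      one = loop_class X (\<lambda>_. x)\<rparr>"

definition universal_cover ::
    "'c::topological_space set \<Rightarrow> ('c \<Rightarrow> 'a::topological_space) \<Rightarrow> 'a set \<Rightarrow> bool" where
  "universal_cover Xt p X \<longleftrightarrow> covering_space Xt p X \<and> simply_connected Xt"

text \<open>The left action of \<open>\<pi>\<^sub>1(X, p xt)\<close> by deck transformations determined by the base point \<open>xt\<close>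
  of the cover: \<open>g\<close> moves \<open>xt\<close> to the end point of the lifts starting at \<open>xt\<close> of the loops in \<open>g\<close>.
  On a universal cover this determines \<open>act\<close>.\<close>

definition deck_action ::
    "'a::topological_space set \<Rightarrow> 'c::topological_space set \<Rightarrow> ('c \<Rightarrow> 'a) \<Rightarrow> 'c \<Rightarrow>
     ((real \<Rightarrow> 'a) set \<Rightarrow> 'c \<Rightarrow> 'c) \<Rightarrow> bool" where
  "deck_action X Xt p xt act \<longleftrightarrow>
     (\<forall>g\<in>carrier (pi1 X (p xt)).
        (\<exists>f. homeomorphism Xt Xt (act g) f) \<and> (\<forall>y\<in>Xt. p (act g y) = p y) \<and>
        (\<forall>q. path q \<and> path_image q \<subseteq> Xt \<and> pathstart q = xt \<and> p \<circ> q \<in> g \<longrightarrow> pathfinish q = act g xt))"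


section \<open>CW structures and cellular cochains\<close>

text \<open>The characteristic map of an \<open>i\<close>-cell is defined on the standard \<open>i\<close>-simplex, used as a
  model of the \<open>i\<close>-ball; so it is a singular simplex, and it carries the orientation of the cell.
  The list \<open>cells i\<close> fixes the order of the \<open>i\<close>-cells.  \<open>skel cells k\<close> is the
  \<open>(k - 1)\<close>-skeleton.\<close>

type_synonym 'a simp = "(nat \<Rightarrow> real) \<Rightarrow> 'a"

definition open_simplex :: "nat \<Rightarrow> (nat \<Rightarrow> real) set" where
  "open_simplex i = {x \<in> standard_simplex i. \<forall>j\<le>i. x j > 0}"

definition skel :: "(nat \<Rightarrow> 'a simp list) \<Rightarrow> nat \<Rightarrow> 'a set" where
  "skel cells k = (\<Union>i<k. \<Union>e\<in>set (cells i). e ` standard_simplex i)"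

text \<open>A finite CW structure of dimension at most \<open>d\<close>.  As there are finitely many cells and \<open>X\<close> is Hausdorff, the open cells automatically carry
  the right topology and \<open>X\<close> has the weak topology.\<close>

definition finite_CW :: "nat \<Rightarrow> 'a::topological_space set \<Rightarrow> (nat \<Rightarrow> 'a simp list) \<Rightarrow> bool" where
  "finite_CW d X cells \<longleftrightarrow>
     Hausdorff_space (top_of_set X) \<and>
     (\<forall>i>d. cells i = []) \<and>
     (\<forall>i. distinct (cells i)) \<and>
     (\<forall>i. \<forall>e\<in>set (cells i). singular_simplex i (top_of_set X) e \<and> inj_on e (open_simplex i) \<and>
        e ` (standard_simplex i - open_simplex i) \<subseteq> skel cells i) \<and>
     (\<forall>i j. \<forall>e\<in>set (cells i). \<forall>e'\<in>set (cells j). (i, e) \<noteq> (j, e') \<longrightarrow>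
        e ` open_simplex i \<inter> e' ` open_simplex j = {}) \<and>
     (\<Union>i. \<Union>e\<in>set (cells i). e ` open_simplex i) = X"

definition cell_lifts ::
    "'c::topological_space set \<Rightarrow> ('c \<Rightarrow> 'a) \<Rightarrow> (nat \<Rightarrow> 'a simp list) \<Rightarrow> (nat \<Rightarrow> 'c simp list) \<Rightarrow> bool" where
  "cell_lifts Xt p cells lifts \<longleftrightarrow>
     (\<forall>i. (\<forall>e\<in>set (lifts i). singular_simplex i (top_of_set Xt) e) \<and>
          map (simplex_map i p) (lifts i) = cells i)"

definition lifted_skel :: "'c set \<Rightarrow> ('c \<Rightarrow> 'a) \<Rightarrow> (nat \<Rightarrow> 'a simp list) \<Rightarrow> nat \<Rightarrow> 'c set" where
  "lifted_skel Xt p cells k = {y \<in> Xt. p y \<in> skel cells k}"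

text \<open>Cellular chains of a filtration \<open>F\<close> in which \<open>F k\<close> is the \<open>(k - 1)\<close>-skeleton; the boundary
  is the one of the triple \<open>(F (i + 2), F (i + 1), F i)\<close>.\<close>

definition cell_group :: "(nat \<Rightarrow> 'a::topological_space set) \<Rightarrow> nat \<Rightarrow> 'a chain set monoid" where
  "cell_group F i = relative_homology_group (int i) (top_of_set (F (Suc i))) (F i)"

definition cell_boundary ::
    "(nat \<Rightarrow> 'a::topological_space set) \<Rightarrow> nat \<Rightarrow> 'a chain set \<Rightarrow> 'a chain set" where
  "cell_boundary F i = hom_relboundary (int (Suc i)) (top_of_set (F (Suc (Suc i)))) (F (Suc i)) (F i)"

definition cell_map ::
    "(nat \<Rightarrow> 'a::topological_space set) \<Rightarrow> ('a \<Rightarrow> 'a) \<Rightarrow> nat \<Rightarrow> 'a chain set \<Rightarrow> 'a chain set" where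
  "cell_map F f i =
     hom_induced (int i) (top_of_set (F (Suc i))) (F i) (top_of_set (F (Suc i))) (F i) f"

definition chain_class ::
    "(nat \<Rightarrow> 'a::topological_space set) \<Rightarrow> nat \<Rightarrow> 'a chain \<Rightarrow> 'a chain set" where
  "chain_class F i c = homologous_rel_set i (top_of_set (F (Suc i))) (F i) c"

text \<open>Additive maps from the cellular chains to the coefficients that are equivariant under all
  \<open>g\<close> in \<open>G\<close>, acting by \<open>act g\<close> on the space and by \<open>R g\<close> on the coefficients.  They are set
  to \<open>0\<close> outside the chain group, so that they form a subspace of the type of functions.\<close>

definition cell_cochains ::
    "(nat \<Rightarrow> 'a::topological_space set) \<Rightarrow> 'g set \<Rightarrow> ('g \<Rightarrow> 'a \<Rightarrow> 'a) \<Rightarrow> ('g \<Rightarrow> 'w \<Rightarrow> 'w) \<Rightarrow> nat \<Rightarrow>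
     ('a chain set \<Rightarrow> 'w::ab_group_add) set" where
  "cell_cochains F G act R i =
     {\<phi>. (\<forall>c. c \<notin> carrier (cell_group F i) \<longrightarrow> \<phi> c = 0) \<and>
          (\<forall>c\<in>carrier (cell_group F i). \<forall>c'\<in>carrier (cell_group F i).
             \<phi> (c \<otimes>\<^bsub>cell_group F i\<^esub> c') = \<phi> c + \<phi> c') \<and>
          (\<forall>g\<in>G. \<forall>c\<in>carrier (cell_group F i). \<phi> (cell_map F (act g) i c) = R g (\<phi> c))}"

definition cell_coboundary ::
    "(nat \<Rightarrow> 'a::topological_space set) \<Rightarrow> nat \<Rightarrow> ('a chain set \<Rightarrow> 'w::ab_group_add) \<Rightarrow> 'a chain set \<Rightarrow> 'w" where
  "cell_coboundary F i \<phi> =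
     (\<lambda>c. if c \<in> carrier (cell_group F (Suc i)) then \<phi> (cell_boundary F i c) else 0)"

definition fun_scale :: "('k \<Rightarrow> 'w \<Rightarrow> 'w) \<Rightarrow> 'k \<Rightarrow> ('x \<Rightarrow> 'w) \<Rightarrow> 'x \<Rightarrow> 'w" where
  "fun_scale s a \<phi> = (\<lambda>x. s a (\<phi> x))"

text \<open>The basis of the cochains dual to the cells \<open>es\<close> tensor the coefficient basis \<open>ws\<close>, in
  lexicographic order.\<close>

definition dual_cell_basis ::
    "('k::field \<Rightarrow> 'w::ab_group_add \<Rightarrow> 'w) \<Rightarrow> (nat \<Rightarrow> 'a::topological_space set) \<Rightarrow> nat \<Rightarrow>
     ('a chain set \<Rightarrow> 'w) set \<Rightarrow> 'a simp list \<Rightarrow> 'w list \<Rightarrow> ('a chain set \<Rightarrow> 'w) list \<Rightarrow> bool" where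
  "dual_cell_basis s F i C es ws c \<longleftrightarrow>
     ordered_basis (fun_scale s) C c \<and> length c = length es * length ws \<and>
     (\<forall>a<length es. \<forall>k<length ws. \<forall>b<length es.
        (c ! (a * length ws + k)) (chain_class F i (frag_of (es ! b))) = (if a = b then ws ! k else 0))"

text \<open>Indices of \<open>\<F>\<^sup>n\<close> range over a finite linearly ordered type \<open>'n\<close>.\<close>

definition standard_basis :: "('f::field ^ 'n::{finite,linorder}) list" where
  "standard_basis = map (\<lambda>k. axis k 1) (sorted_list_of_set UNIV)"

definition twisted_cochains ::
    "'a::topological_space set \<Rightarrow> 'c::topological_space set \<Rightarrow> ('c \<Rightarrow> 'a) \<Rightarrow> 'c \<Rightarrow>
     ((real \<Rightarrow> 'a) set \<Rightarrow> 'c \<Rightarrow> 'c) \<Rightarrow> ((real \<Rightarrow> 'a) set \<Rightarrow> 'f::field ^ 'n ^ 'n) \<Rightarrow> (nat \<Rightarrow> 'a simp list) \<Rightarrow>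
     nat \<Rightarrow> ('c chain set \<Rightarrow> 'f ^ 'n) set" where
  "twisted_cochains X Xt p xt act \<rho> cells =
     cell_cochains (lifted_skel Xt p cells) (carrier (pi1 X (p xt))) act (\<lambda>g v. \<rho> g *v v)"

definition real_cochains ::
    "(nat \<Rightarrow> 'a::topological_space simp list) \<Rightarrow> nat \<Rightarrow> ('a chain set \<Rightarrow> real) set" where
  "real_cochains cells = cell_cochains (skel cells) ({} :: unit set) (\<lambda>_. id) (\<lambda>_. id)"


section \<open>The cohomology pairing\<close>

definition chain_eval :: "('k::ring_1 \<Rightarrow> 'w::ab_group_add \<Rightarrow> 'w) \<Rightarrow> ('a simp \<Rightarrow> 'w) \<Rightarrow> 'a chain \<Rightarrow> 'w" where
  "chain_eval s \<phi> c = (\<Sum>\<sigma>\<in>Poly_Mapping.keys c. s (of_int (Poly_Mapping.lookup c \<sigma>)) (\<phi> \<sigma>))"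

text \<open>Equivariant singular cocycles of the cover, given by their values on singular simplices.\<close>

definition singular_twisted_cocycle ::
    "'a::topological_space set \<Rightarrow> 'c::topological_space set \<Rightarrow> ('c \<Rightarrow> 'a) \<Rightarrow> 'c \<Rightarrow>
     ((real \<Rightarrow> 'a) set \<Rightarrow> 'c \<Rightarrow> 'c) \<Rightarrow> ((real \<Rightarrow> 'a) set \<Rightarrow> 'f::field ^ 'n ^ 'n) \<Rightarrow>
     nat \<Rightarrow> ('c simp \<Rightarrow> 'f ^ 'n) \<Rightarrow> bool" where
  "singular_twisted_cocycle X Xt p xt act \<rho> i \<phi> \<longleftrightarrow>
     (\<forall>g\<in>carrier (pi1 X (p xt)). \<forall>\<sigma>. singular_simplex i (top_of_set Xt) \<sigma> \<longrightarrow>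
        \<phi> (simplex_map i (act g) \<sigma>) = \<rho> g *v \<phi> \<sigma>) \<and>
     (\<forall>\<sigma>. singular_simplex (Suc i) (top_of_set Xt) \<sigma> \<longrightarrow>
        chain_eval (*s) \<phi> (chain_boundary (Suc i) (frag_of \<sigma>)) = 0)"

text \<open>The canonical identification of cellular with singular cohomology: each singular class
  contains a cocycle that vanishes on the \<open>(i - 1)\<close>-skeleton, and such a cocycle induces a
  cellular cocycle by evaluation on the relative cycles of consecutive skeleta.\<close>

definition represents_cellular ::
    "(nat \<Rightarrow> 'c::topological_space set) \<Rightarrow> nat \<Rightarrow> ('c simp \<Rightarrow> 'f::field ^ 'n) \<Rightarrow> ('c chain set \<Rightarrow> 'f ^ 'n) \<Rightarrow> bool" where
  "represents_cellular F i \<phi> u \<longleftrightarrow>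
     (\<forall>\<sigma>. singular_simplex i (top_of_set (F i)) \<sigma> \<longrightarrow> \<phi> \<sigma> = 0) \<and>
     (\<forall>c. singular_relcycle i (top_of_set (F (Suc i))) (F i) c \<longrightarrow>
        u (chain_class F i c) = chain_eval (*s) \<phi> c)"

definition front_face :: "nat \<Rightarrow> 'a simp \<Rightarrow> 'a simp" where
  "front_face i \<sigma> = restrict \<sigma> (standard_simplex i)"

definition back_face :: "nat \<Rightarrow> nat \<Rightarrow> 'a simp \<Rightarrow> 'a simp" where
  "back_face i j \<sigma> = restrict (\<lambda>x. \<sigma> (\<lambda>k. if k < i then 0 else x (k - i))) (standard_simplex j)"

definition cup_form ::
    "('w \<Rightarrow> 'w \<Rightarrow> 'f) \<Rightarrow> nat \<Rightarrow> nat \<Rightarrow> ('a simp \<Rightarrow> 'w) \<Rightarrow> ('a simp \<Rightarrow> 'w) \<Rightarrow> 'a simp \<Rightarrow> 'f" where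
  "cup_form \<psi> i j \<phi> \<eta> \<sigma> = \<psi> (\<phi> (front_face i \<sigma>)) (\<eta> (back_face i j \<sigma>))"

text \<open>The value of \<open>\<psi>\<^sub>*((x \<smile> y) \<inter> [X])\<close> for classes \<open>x\<close>, \<open>y\<close> of degrees \<open>i\<close>, \<open>j\<close>.
  Since the cup product composed with \<open>\<psi>\<close> is invariant under deck transformations, it is evaluated
  on a cycle of \<open>X\<close> by lifting the simplices of the cycle to the cover in any way.  The value does not depend on the
  representatives \<open>\<phi>\<close>, \<open>\<eta>\<close> and \<open>z\<close>.\<close>

definition cup_pairing ::
    "'a::topological_space set \<Rightarrow> 'c::topological_space set \<Rightarrow> ('c \<Rightarrow> 'a) \<Rightarrow> 'c \<Rightarrow>
     ((real \<Rightarrow> 'a) set \<Rightarrow> 'c \<Rightarrow> 'c) \<Rightarrow> ((real \<Rightarrow> 'a) set \<Rightarrow> 'f::field ^ 'n ^ 'n) \<Rightarrow> (nat \<Rightarrow> 'a simp list) \<Rightarrow>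
     'a chain set \<Rightarrow> ('f ^ 'n \<Rightarrow> 'f ^ 'n \<Rightarrow> 'f) \<Rightarrow> nat \<Rightarrow> nat \<Rightarrow>
     ('c chain set \<Rightarrow> 'f ^ 'n) set \<Rightarrow> ('c chain set \<Rightarrow> 'f ^ 'n) set \<Rightarrow> 'f" where
  "cup_pairing X Xt p xt act \<rho> cells \<zeta> \<psi> i j x y =
     (THE r. \<exists>u\<in>x. \<exists>w\<in>y. \<exists>\<phi> \<eta> z.
        singular_twisted_cocycle X Xt p xt act \<rho> i \<phi> \<and>
        represents_cellular (lifted_skel Xt p cells) i \<phi> u \<and>
        singular_twisted_cocycle X Xt p xt act \<rho> j \<eta> \<and>
        represents_cellular (lifted_skel Xt p cells) j \<eta> w \<and>
        singular_chain (i + j) (top_of_set Xt) z \<and> chain_map (i + j) p z \<in> \<zeta> \<and>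
        r = chain_eval (*) (cup_form \<psi> i j \<phi> \<eta>) z)"

definition dual_classes :: "('w \<Rightarrow> 'w \<Rightarrow> 'f::field) \<Rightarrow> 'w list \<Rightarrow> 'w list \<Rightarrow> bool" where
  "dual_classes P hs ks \<longleftrightarrow> length ks = length hs \<and>
     (\<forall>a<length hs. \<forall>b<length hs. P (hs ! a) (ks ! b) = (if a = b then 1 else 0))"


section \<open>Refined torsion\<close>

text \<open>\<open>hR i\<close> is an ordered basis of \<open>H\<^sup>i(X; \<real>)\<close> and \<open>cR i\<close> the cellular basis of \<open>C\<^sup>i(X; \<real>)\<close>, so that
  their lengths are the dimensions.\<close>

definition torsion_parity :: "nat \<Rightarrow> (nat \<Rightarrow> 'h list) \<Rightarrow> (nat \<Rightarrow> 'b list) \<Rightarrow> nat" where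
  "torsion_parity d hR cR =
     (\<Sum>i\<le>d. (\<Sum>j\<le>i. length (hR (d - j))) * (\<Sum>j\<le>i. length (cR (d - j))))"

definition tau_tilde ::
    "nat \<Rightarrow> (nat \<Rightarrow> 'a::topological_space simp list) \<Rightarrow> (nat \<Rightarrow> ('a chain set \<Rightarrow> real) list) \<Rightarrow>
     (nat \<Rightarrow> ('a chain set \<Rightarrow> real) set list) \<Rightarrow> real" where
  "tau_tilde d cells cR hR =
     (-1) ^ torsion_parity d hR cR *
     torsion (fun_scale (*)) d (real_cochains cells) (cell_coboundary (skel cells)) cR hR"

text \<open>A representative in \<open>\<F>\<^sup>\<times>\<close> of the refined torsion.  The orientation of the real cohomology
  enters as the one for which the basis \<open>hR\<close> is positive.\<close>

definition refined_torsion_rep ::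
    "nat \<Rightarrow> 'a::topological_space set \<Rightarrow> 'c::topological_space set \<Rightarrow> ('c \<Rightarrow> 'a) \<Rightarrow> 'c \<Rightarrow>
     ((real \<Rightarrow> 'a) set \<Rightarrow> 'c \<Rightarrow> 'c) \<Rightarrow> ((real \<Rightarrow> 'a) set \<Rightarrow> 'f::field ^ 'n::finite ^ 'n) \<Rightarrow>
     (nat \<Rightarrow> 'a simp list) \<Rightarrow> (nat \<Rightarrow> ('a chain set \<Rightarrow> real) list) \<Rightarrow>
     (nat \<Rightarrow> ('a chain set \<Rightarrow> real) set list) \<Rightarrow> (nat \<Rightarrow> ('c chain set \<Rightarrow> 'f ^ 'n) list) \<Rightarrow>
     (nat \<Rightarrow> ('c chain set \<Rightarrow> 'f ^ 'n) set list) \<Rightarrow> 'f" where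
  "refined_torsion_rep d X Xt p xt act \<rho> cells cR hR c h =
     (if tau_tilde d cells cR hR < 0 then -1 else 1) ^ CARD('n) *
     torsion (fun_scale (*s)) d (twisted_cochains X Xt p xt act \<rho> cells)
       (cell_coboundary (lifted_skel Xt p cells)) c h"

definition det_image :: "'a::topological_space set \<Rightarrow> 'a \<Rightarrow> ((real \<Rightarrow> 'a) set \<Rightarrow> 'f::field ^ 'n ^ 'n) \<Rightarrow> 'f set" where
  "det_image X x \<rho> = {Determinants.det (\<rho> g) | g. g \<in> carrier (pi1 X x)}"

definition torsion_subgroup ::
    "('f::field \<Rightarrow> 'f) \<Rightarrow> 'a::topological_space set \<Rightarrow> 'a \<Rightarrow> ((real \<Rightarrow> 'a) set \<Rightarrow> 'f ^ 'n ^ 'n) \<Rightarrow> 'f set" where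
  "torsion_subgroup \<iota> X x \<rho> = generate field_units (norm_set \<iota> \<union> det_image X x \<rho>)"

definition refined_torsion ::
    "('f::field \<Rightarrow> 'f) \<Rightarrow> nat \<Rightarrow> 'a::topological_space set \<Rightarrow> 'c::topological_space set \<Rightarrow> ('c \<Rightarrow> 'a) \<Rightarrow> 'c \<Rightarrow>
     ((real \<Rightarrow> 'a) set \<Rightarrow> 'c \<Rightarrow> 'c) \<Rightarrow> ((real \<Rightarrow> 'a) set \<Rightarrow> 'f ^ 'n::finite ^ 'n) \<Rightarrow>
     (nat \<Rightarrow> 'a simp list) \<Rightarrow> (nat \<Rightarrow> ('a chain set \<Rightarrow> real) list) \<Rightarrow>
     (nat \<Rightarrow> ('a chain set \<Rightarrow> real) set list) \<Rightarrow> (nat \<Rightarrow> ('c chain set \<Rightarrow> 'f ^ 'n) list) \<Rightarrow>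
     (nat \<Rightarrow> ('c chain set \<Rightarrow> 'f ^ 'n) set list) \<Rightarrow> 'f set" where
  "refined_torsion \<iota> d X Xt p xt act \<rho> cells cR hR c h =
     torsion_subgroup \<iota> X (p xt) \<rho> #>\<^bsub>field_units\<^esub>
       refined_torsion_rep d X Xt p xt act \<rho> cells cR hR c h"

definition symmetric_family :: "nat \<Rightarrow> (nat \<Rightarrow> 'h list) \<Rightarrow> (nat \<Rightarrow> 'h list) \<Rightarrow> nat \<Rightarrow> 'h list" where
  "symmetric_family m h hdual j = (if j \<le> m then h j else hdual (2 * m + 1 - j))"

end

theory Submission
  imports Defs
begin

text \<open>
  A change of cohomology bases by matrices \<open>A\<^sub>i\<close> multiplies the torsion by the alternating product of
  their determinants, \<open>\<Prod>\<^sub>i det (A\<^sub>i) powi ((-1) ^ Suc i)\<close> (\<open>torsion_change\<close>).  Indeed the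
  bases of \<open>C\<^sup>i\<close> in the definition of the torsion, made of a basis of \<open>B\<^sup>i\<close>, representatives of the
  cohomology basis and lifts of a basis of the next coboundaries, are adapted to the filtration
  \<open>0 \<subseteq> B\<^sup>i \<subseteq> Z\<^sup>i \<subseteq> C\<^sup>i\<close>, the transition between two adapted bases is block triangular, and each base change of the coboundaries occurs in two
  neighbouring degrees with opposite exponents.  The same computation shows that the torsion is well
  defined and nonzero.

  If the bases in degrees \<open>j\<close> and \<open>d - j\<close> are kept dual under a sesquilinear pairing, the determinants
  of their base changes are related by \<open>\<iota> (det A\<^sub>j) * det A\<^sub>d\<^sub>-\<^sub>j = 1\<close> (\<open>sesquilinear_pairing_det\<close>).  As \<open>d\<close> is
  odd, the exponents in these degrees are opposite, and together they contribute \<open>a * \<iota> a\<close> with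
  \<open>a = det A\<^sub>j\<close> or its inverse.  So the two torsions differ by a norm
  (\<open>torsion_symmetric_family_norm\<close>), and their classes modulo norms agree.

  On the topological side, the equivariant cellular cochains have to form a complex of finite length
  (\<open>based_complex_twisted_cochains\<close>).  They do because the cellular boundary squares to zero, commutes with deck
  transformations, and there are no cells above the dimension.
\<close>

section \<open>Bases of quotients and their transition matrices\<close>

definition lin_sum :: "('k::field \<Rightarrow> 'v::ab_group_add \<Rightarrow> 'v) \<Rightarrow> 'v list \<Rightarrow> (nat \<Rightarrow> 'k) \<Rightarrow> 'v" where
  "lin_sum s xs a = (\<Sum>i<length xs. s (a i) (xs ! i))"

text \<open>Ordered bases of \<open>Z / B\<close> given by representatives.  With \<open>B = {0}\<close> this covers bases of subspaces, so that bases of coboundaries, representatives of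
  cohomology bases, and lifts along the coboundary map are all instances of one notion.\<close>

definition basis_mod :: "('k::field \<Rightarrow> 'v::ab_group_add \<Rightarrow> 'v) \<Rightarrow> 'v set \<Rightarrow> 'v set \<Rightarrow> 'v list \<Rightarrow> bool" where
  "basis_mod s Z B xs \<longleftrightarrow> set xs \<subseteq> Z \<and> (\<forall>z\<in>Z. \<exists>a. z - lin_sum s xs a \<in> B) \<and>
     (\<forall>a. lin_sum s xs a \<in> B \<longrightarrow> (\<forall>i<length xs. a i = 0))"

text \<open>Column \<open>j\<close> of \<open>M\<close> holds coordinates of \<open>ys ! j\<close> with respect to \<open>xs\<close>, modulo \<open>B\<close>.\<close>

definition transition ::
    "('k::field \<Rightarrow> 'v::ab_group_add \<Rightarrow> 'v) \<Rightarrow> 'v set \<Rightarrow> 'v list \<Rightarrow> 'v list \<Rightarrow> 'k mat \<Rightarrow> bool" where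
  "transition s B xs ys M \<longleftrightarrow> M \<in> carrier_mat (length xs) (length xs) \<and> length ys = length xs \<and>
     (\<forall>j<length xs. ys ! j - lin_sum s xs (\<lambda>i. M $$ (i, j)) \<in> B)"

context vector_space
begin

lemma lin_sum_diff: "lin_sum scale xs (\<lambda>i. a i - b i) = lin_sum scale xs a - lin_sum scale xs b"
  by (simp add: lin_sum_def scale_left_diff_distrib sum_subtractf)

lemma lin_sum_zero: "(\<And>i. i < length xs \<Longrightarrow> a i = 0) \<Longrightarrow> lin_sum scale xs a = 0"
  by (simp add: lin_sum_def)

lemma lin_sum_cong: "(\<And>i. i < length xs \<Longrightarrow> a i = b i) \<Longrightarrow> lin_sum scale xs a = lin_sum scale xs b"
  by (simp add: lin_sum_def)

lemma lin_sum_append: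
  "lin_sum scale (xs @ ys) a = lin_sum scale xs a + lin_sum scale ys (\<lambda>i. a (length xs + i))"
proof -
  have "lin_sum scale (xs @ ys) a =
      (\<Sum>i\<in>{0..<length xs}. scale (a i) ((xs @ ys) ! i)) +
      (\<Sum>i\<in>{length xs..<length xs + length ys}. scale (a i) ((xs @ ys) ! i))"
    unfolding lin_sum_def
    by (subst sum.atLeastLessThan_concat) (auto simp: atLeast0LessThan)
  also have "(\<Sum>i\<in>{length xs..<length xs + length ys}. scale (a i) ((xs @ ys) ! i)) =
      lin_sum scale ys (\<lambda>i. a (length xs + i))"
    using sum.shift_bounds_nat_ivl[of "\<lambda>i. scale (a i) ((xs @ ys) ! i)" 0 "length xs" "length ys"]
    by (simp add: lin_sum_def atLeast0LessThan add.commute nth_append)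
  finally show ?thesis
    by (simp add: lin_sum_def atLeast0LessThan nth_append)
qed

lemma lin_sum_unit: "j < length xs \<Longrightarrow> lin_sum scale xs (\<lambda>i. if i = j then 1 else 0) = xs ! j"
  by (simp add: lin_sum_def if_distrib[where f = "\<lambda>x. scale x _"] cong: if_cong)

lemma lin_sum_in: "subspace V \<Longrightarrow> set xs \<subseteq> V \<Longrightarrow> lin_sum scale xs a \<in> V"
  unfolding lin_sum_def by (intro subspace_sum subspace_scale) auto

text \<open>Expressing each \<open>ys ! j\<close> through \<open>xs\<close> modulo \<open>B\<close> turns a combination of \<open>ys\<close> into one of
  \<open>xs\<close>; this is what matrix multiplication encodes.\<close>

lemma lin_sum_substitute:
  assumes "subspace B" "\<And>j. j < length ys \<Longrightarrow> ys ! j - lin_sum scale xs (M j) \<in> B"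
  shows "lin_sum scale ys b - lin_sum scale xs (\<lambda>i. \<Sum>j<length ys. M j i * b j) \<in> B"
proof -
  have "lin_sum scale xs (\<lambda>i. \<Sum>j<length ys. M j i * b j) =
      (\<Sum>i<length xs. \<Sum>j<length ys. scale (M j i * b j) (xs ! i))"
    by (simp add: lin_sum_def scale_sum_left)
  also have "\<dots> = (\<Sum>j<length ys. scale (b j) (lin_sum scale xs (M j)))"
    by (subst sum.swap) (simp add: lin_sum_def scale_sum_right mult.commute)
  finally have "lin_sum scale ys b - lin_sum scale xs (\<lambda>i. \<Sum>j<length ys. M j i * b j) =
      (\<Sum>j<length ys. scale (b j) (ys ! j - lin_sum scale xs (M j)))"
    by (simp add: lin_sum_def[of _ ys] scale_right_diff_distrib sum_subtractf)
  also have "\<dots> \<in> B"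
    using assms by (intro subspace_sum subspace_scale) auto
  finally show ?thesis .
qed

lemma transition_trans:
  assumes B: "subspace B" and M: "transition scale B xs ys M" and N: "transition scale B ys zs N"
  shows "transition scale B xs zs (M * N)"
  unfolding transition_def
proof (intro conjI allI impI)
  show "M * N \<in> carrier_mat (length xs) (length xs)" "length zs = length xs"
    using M N by (auto simp: transition_def)
  fix j assume j: "j < length xs"
  have "zs ! j - lin_sum scale ys (\<lambda>i. N $$ (i, j)) \<in> B"
    using N M j by (auto simp: transition_def)
  moreover have "lin_sum scale ys (\<lambda>i. N $$ (i, j)) -
      lin_sum scale xs (\<lambda>i. \<Sum>l<length ys. M $$ (i, l) * N $$ (l, j)) \<in> B"
    using M by (intro lin_sum_substitute B) (auto simp: transition_def)
  moreover have "lin_sum scale xs (\<lambda>i. \<Sum>l<length ys. M $$ (i, l) * N $$ (l, j)) =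
      lin_sum scale xs (\<lambda>i. (M * N) $$ (i, j))"
    using M N j
    by (intro lin_sum_cong) (auto simp: transition_def scalar_prod_def atLeast0LessThan)
  ultimately show "zs ! j - lin_sum scale xs (\<lambda>i. (M * N) $$ (i, j)) \<in> B"
    using subspace_add[OF B] by fastforce
qed

lemma transition_unique:
  assumes B: "subspace B" and xs: "basis_mod scale Z B xs"
    and M: "transition scale B xs ys M" and N: "transition scale B xs ys N"
  shows "M = N"
proof (rule eq_matI)
  show "dim_row M = dim_row N" "dim_col M = dim_col N"
    using M N by (auto simp: transition_def)
  fix i j assume "i < dim_row N" "j < dim_col N"
  then have ij: "i < length xs" "j < length xs"
    using N by (auto simp: transition_def)
  have "(ys ! j - lin_sum scale xs (\<lambda>i. N $$ (i, j))) - (ys ! j - lin_sum scale xs (\<lambda>i. M $$ (i, j))) \<in> B"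
    by (rule subspace_diff[OF B]) (use M N ij in \<open>auto simp: transition_def\<close>)
  then have "lin_sum scale xs (\<lambda>i. M $$ (i, j) - N $$ (i, j)) \<in> B"
    by (simp add: lin_sum_diff)
  then show "M $$ (i, j) = N $$ (i, j)"
    using xs ij by (fastforce simp: basis_mod_def)
qed

lemma transition_exists:
  assumes xs: "basis_mod scale Z B xs" and ys: "set ys \<subseteq> Z" "length ys = length xs"
  obtains M where "transition scale B xs ys M"
proof -
  have "\<forall>j<length xs. \<exists>a. ys ! j - lin_sum scale xs a \<in> B"
    using xs ys unfolding basis_mod_def by (metis nth_mem subsetD)
  then obtain a where a: "\<And>j. j < length xs \<Longrightarrow> ys ! j - lin_sum scale xs (a j) \<in> B"
    by metis
  have "transition scale B xs ys (Matrix.mat (length xs) (length xs) (\<lambda>(i, j). a j i))"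
    unfolding transition_def
  proof (intro conjI allI impI)
    fix j assume j: "j < length xs"
    have "lin_sum scale xs (\<lambda>i. Matrix.mat (length xs) (length xs) (\<lambda>(i, j). a j i) $$ (i, j)) =
        lin_sum scale xs (a j)"
      using j by (intro lin_sum_cong) auto
    then show "ys ! j - lin_sum scale xs (\<lambda>i. Matrix.mat (length xs) (length xs) (\<lambda>(i, j). a j i) $$ (i, j)) \<in> B"
      using a[OF j] by simp
  qed (use ys in auto)
  then show thesis by (rule that)
qed

lemma transition_one:
  assumes "length ys = length xs" "\<And>j. j < length xs \<Longrightarrow> ys ! j - xs ! j \<in> B"
  shows "transition scale B xs ys (1\<^sub>m (length xs))"
  unfolding transition_def
proof (intro conjI allI impI)
  fix j assume j: "j < length xs"
  have "lin_sum scale xs (\<lambda>i. 1\<^sub>m (length xs) $$ (i, j)) = xs ! j"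
    using j by (subst lin_sum_unit[OF j, symmetric], intro lin_sum_cong) auto
  then show "ys ! j - lin_sum scale xs (\<lambda>i. 1\<^sub>m (length xs) $$ (i, j)) \<in> B"
    using assms j by simp
qed (use assms in auto)

text \<open>The transition back to \<open>xs\<close> gives an inverse matrix, by uniqueness of transition matrices.\<close>

lemma transition_det_nonzero:
  assumes B: "subspace B" and xs: "basis_mod scale Z B xs" and ys: "basis_mod scale Z B ys"
    and M: "transition scale B xs ys M"
  shows "Determinant.det M \<noteq> 0"
proof -
  have len: "length ys = length xs" using M by (simp add: transition_def)
  obtain N where N: "transition scale B ys xs N"
    using transition_exists[OF ys, of xs] xs len by (auto simp: basis_mod_def)
  have "transition scale B xs xs (1\<^sub>m (length xs))"
    by (rule transition_one) (use B subspace_0 in auto)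
  then have MN: "M * N = 1\<^sub>m (length xs)"
    using transition_unique[OF B xs transition_trans[OF B M N]] by simp
  have "Determinant.det M * Determinant.det N = Determinant.det (M * N)"
    using M N len by (intro det_mult[symmetric, of _ "length xs"]) (auto simp: transition_def)
  then show ?thesis using MN by auto
qed

text \<open>If \<open>ys\<close> were longer than \<open>xs\<close>, its coordinate matrix padded with zero rows to a square matrix
  would be singular, and a kernel vector would be a nontrivial relation among \<open>ys\<close> modulo \<open>B\<close>.\<close>

lemma basis_mod_length_le:
  assumes B: "subspace B" and xs: "basis_mod scale Z B xs" and ys: "basis_mod scale Z B ys"
  shows "length ys \<le> length xs"
proof (rule ccontr)
  assume "\<not> length ys \<le> length xs"
  then have lt: "length xs < length ys" by simp
  have "\<forall>j<length ys. \<exists>a. ys ! j - lin_sum scale xs a \<in> B"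
    using xs ys unfolding basis_mod_def by (metis nth_mem subsetD)
  then obtain a where a: "\<And>j. j < length ys \<Longrightarrow> ys ! j - lin_sum scale xs (a j) \<in> B"
    by metis
  define n where "n = length ys"
  define N where "N = Matrix.mat n n (\<lambda>(i, j). if i < length xs then a j i else 0)"
  have N: "N \<in> carrier_mat n n" by (simp add: N_def)
  have "Determinant.det N = 0"
  proof -
    have "N = multrow (length xs) 0 N"
      using lt by (auto simp: N_def n_def intro!: eq_matI)
    then have "Determinant.det N = 0 * Determinant.det N"
      using det_multrow[OF _ N, of "length xs" 0] lt by (simp add: n_def)
    then show ?thesis by simp
  qed
  then obtain v where v: "v \<in> carrier_vec n" "v \<noteq> 0\<^sub>v n" "N *\<^sub>v v = 0\<^sub>v n"
    using det_0_iff_vec_prod_zero_field[OF N] by auto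
  have "lin_sum scale ys (vec_index v) - lin_sum scale xs (\<lambda>i. \<Sum>j<length ys. a j i * vec_index v j) \<in> B"
    by (intro lin_sum_substitute B a)
  moreover have "lin_sum scale xs (\<lambda>i. \<Sum>j<length ys. a j i * vec_index v j) = 0"
  proof (rule lin_sum_zero)
    fix i assume i: "i < length xs"
    have "0 = vec_index (N *\<^sub>v v) i" using v i lt by (simp add: n_def)
    also have "\<dots> = (\<Sum>j<length ys. a j i * vec_index v j)"
      using i lt v(1) by (simp add: N_def n_def scalar_prod_def atLeast0LessThan)
    finally show "(\<Sum>j<length ys. a j i * vec_index v j) = 0" by simp
  qed
  ultimately have "\<forall>i<length ys. vec_index v i = 0"
    using ys by (simp add: basis_mod_def)
  then have "v = 0\<^sub>v n" using v(1) by (intro eq_vecI) (auto simp: n_def)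
  then show False using v by simp
qed

lemma basis_mod_length_eq:
  "subspace B \<Longrightarrow> basis_mod scale Z B xs \<Longrightarrow> basis_mod scale Z B ys \<Longrightarrow> length ys = length xs"
  by (intro antisym basis_mod_length_le)

text \<open>A basis of \<open>V / W\<close> followed by lifts of a basis of \<open>U / V\<close> is a basis of \<open>U / W\<close>.  Applied twice
  to \<open>0 \<subseteq> B\<^sup>i \<subseteq> Z\<^sup>i \<subseteq> C\<^sup>i\<close> this yields the bases that enter the torsion.\<close>

lemma basis_mod_append:
  assumes V: "subspace V" "V \<subseteq> U" and W: "W \<subseteq> V"
    and xs: "basis_mod scale V W xs" and ys: "basis_mod scale U V ys"
  shows "basis_mod scale U W (xs @ ys)"
  unfolding basis_mod_def
proof (intro conjI ballI allI impI)
  show "set (xs @ ys) \<subseteq> U" using xs ys V by (auto simp: basis_mod_def)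
  fix z assume "z \<in> U"
  then obtain b where b: "z - lin_sum scale ys b \<in> V" using ys by (auto simp: basis_mod_def)
  then obtain a where a: "z - lin_sum scale ys b - lin_sum scale xs a \<in> W"
    using xs by (auto simp: basis_mod_def)
  let ?c = "\<lambda>i. if i < length xs then a i else b (i - length xs)"
  have "lin_sum scale xs ?c = lin_sum scale xs a" by (rule lin_sum_cong) simp
  then have "lin_sum scale (xs @ ys) ?c = lin_sum scale xs a + lin_sum scale ys b"
    by (simp add: lin_sum_append)
  then have "z - lin_sum scale (xs @ ys) ?c \<in> W" using a by (simp add: algebra_simps)
  then show "\<exists>a. z - lin_sum scale (xs @ ys) a \<in> W" by blast
next
  fix a i assume a: "lin_sum scale (xs @ ys) a \<in> W" and i: "i < length (xs @ ys)"
  have x: "lin_sum scale xs a \<in> V"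
    using xs by (intro lin_sum_in V) (auto simp: basis_mod_def)
  have y: "lin_sum scale ys (\<lambda>i. a (length xs + i)) \<in> V"
    using subspace_diff[OF V(1), of "lin_sum scale (xs @ ys) a" "lin_sum scale xs a"] a W x
    by (auto simp: lin_sum_append)
  then have ay: "\<forall>i<length ys. a (length xs + i) = 0"
    using ys unfolding basis_mod_def by (metis (mono_tags, lifting))
  then have "lin_sum scale ys (\<lambda>i. a (length xs + i)) = 0" by (intro lin_sum_zero) simp
  then have "lin_sum scale xs a \<in> W" using a by (simp add: lin_sum_append)
  then have ax: "\<forall>i<length xs. a i = 0" using xs by (auto simp: basis_mod_def)
  show "a i = 0"
  proof (cases "i < length xs")
    case False
    then have "i - length xs < length ys" using i by auto
    then have "a (length xs + (i - length xs)) = 0" using ay by blast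
    then show ?thesis using False by simp
  qed (use ax in simp)
qed

text \<open>Changing a basis that is adapted to \<open>W \<subseteq> V \<subseteq> U\<close> into another adapted one is described by a block
  upper triangular matrix: the diagonal blocks are the transitions in \<open>V / W\<close> and \<open>U / V\<close>, and the
  upper right block corrects the lifts by elements of \<open>V\<close>, which does not affect the determinant.\<close>

lemma transition_append:
  assumes W: "subspace W" and xs: "basis_mod scale V W xs"
    and P: "transition scale W xs xs' P" and Q: "transition scale V ys ys' Q"
  obtains M where "transition scale W (xs @ ys) (xs' @ ys') M"
    and "Determinant.det M = Determinant.det P * Determinant.det Q"
proof -
  let ?n = "length xs" and ?m = "length ys"
  have P': "P \<in> carrier_mat ?n ?n" "length xs' = ?n"
      "\<And>j. j < ?n \<Longrightarrow> xs' ! j - lin_sum scale xs (\<lambda>i. P $$ (i, j)) \<in> W"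
    and Q': "Q \<in> carrier_mat ?m ?m" "length ys' = ?m"
      "\<And>j. j < ?m \<Longrightarrow> ys' ! j - lin_sum scale ys (\<lambda>i. Q $$ (i, j)) \<in> V"
    using P Q by (auto simp: transition_def)
  have "\<forall>j<?m. \<exists>r. ys' ! j - lin_sum scale ys (\<lambda>i. Q $$ (i, j)) - lin_sum scale xs r \<in> W"
    using Q' xs by (auto simp: basis_mod_def)
  then obtain r where r: "\<And>j. j < ?m \<Longrightarrow>
      ys' ! j - lin_sum scale ys (\<lambda>i. Q $$ (i, j)) - lin_sum scale xs (r j) \<in> W"
    by metis
  define R where "R = Matrix.mat ?n ?m (\<lambda>(i, j). r j i)"
  define M where "M = four_block_mat P R (0\<^sub>m ?m ?n) Q"
  have R: "R \<in> carrier_mat ?n ?m" by (simp add: R_def)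
  have "transition scale W (xs @ ys) (xs' @ ys') M"
    unfolding transition_def
  proof (intro conjI allI impI)
    show "M \<in> carrier_mat (length (xs @ ys)) (length (xs @ ys))"
      using P' Q' by (simp add: M_def)
    fix j assume j: "j < length (xs @ ys)"
    show "(xs' @ ys') ! j - lin_sum scale (xs @ ys) (\<lambda>i. M $$ (i, j)) \<in> W"
    proof (cases "j < ?n")
      case True
      have "lin_sum scale xs (\<lambda>i. M $$ (i, j)) = lin_sum scale xs (\<lambda>i. P $$ (i, j))"
        using True P' Q' R by (intro lin_sum_cong) (auto simp: M_def)
      moreover have "lin_sum scale ys (\<lambda>i. M $$ (?n + i, j)) = 0"
        using True P' Q' R by (intro lin_sum_zero) (auto simp: M_def)
      ultimately show ?thesis
        using P'(3)[OF True] True P'(2) by (simp add: lin_sum_append nth_append)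
    next
      case False
      define l where "l = j - ?n"
      have l: "j = ?n + l" "l < ?m" using False j by (auto simp: l_def)
      have "lin_sum scale xs (\<lambda>i. M $$ (i, j)) = lin_sum scale xs (r l)"
        using l P' Q' R by (intro lin_sum_cong) (auto simp: M_def R_def)
      moreover have "lin_sum scale ys (\<lambda>i. M $$ (?n + i, j)) = lin_sum scale ys (\<lambda>i. Q $$ (i, l))"
        using l P' Q' R by (intro lin_sum_cong) (auto simp: M_def)
      ultimately show ?thesis
        using r[OF l(2)] l P'(2) by (simp add: lin_sum_append nth_append algebra_simps)
    qed
  qed (use P' Q' in auto)
  moreover have "Determinant.det M = Determinant.det P * Determinant.det Q"
    unfolding M_def by (intro det_four_block_mat_lower_left_zero[OF P'(1) R _ Q'(1)]) auto
  ultimately show thesis by (rule that)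
qed

lemma lin_sum_set:
  assumes "distinct xs"
  shows "lin_sum scale xs (\<lambda>i. f (xs ! i)) = (\<Sum>x\<in>set xs. scale (f x) x)"
  unfolding lin_sum_def
  using sum.reindex_bij_betw[OF bij_betw_nth[OF assms, of "{..<length xs}" "set xs"], of "\<lambda>x. scale (f x) x"]
  by simp

lemma ordered_basis_subspace: "ordered_basis scale V xs \<Longrightarrow> subspace V"
  by (auto simp: ordered_basis_def)

lemma representation_lin_sum:
  assumes xs: "ordered_basis scale V xs" and j: "j < length xs"
  shows "representation (set xs) (lin_sum scale xs a) (xs ! j) = a j"
proof -
  have ind: "independent (set xs)" and dist: "distinct xs" and sp: "span (set xs) = V"
    using xs by (auto simp: ordered_basis_def)
  have mem: "xs ! i \<in> span (set xs)" if "i < length xs" for i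
    using that by (intro span_base) auto
  have "representation (set xs) (lin_sum scale xs a) (xs ! j) =
      (\<Sum>i<length xs. a i * representation (set xs) (xs ! i) (xs ! j))"
    unfolding lin_sum_def using mem
    by (subst representation_sum[OF ind]) (auto simp: representation_scale[OF ind] span_scale)
  also have "\<dots> = (\<Sum>i<length xs. if i = j then a i else 0)"
    using dist j by (intro sum.cong refl) (auto simp: representation_basis[OF ind] nth_eq_iff_index_eq)
  also have "\<dots> = a j" using j by simp
  finally show ?thesis .
qed

lemma ordered_basis_imp_basis_mod:
  assumes xs: "ordered_basis scale V xs"
  shows "basis_mod scale V {0} xs"
  unfolding basis_mod_def
proof (intro conjI ballI allI impI)
  have ind: "independent (set xs)" and dist: "distinct xs" and sp: "span (set xs) = V"
    using xs by (auto simp: ordered_basis_def)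
  show "set xs \<subseteq> V" using sp span_superset by auto
  fix z assume "z \<in> V"
  then have "lin_sum scale xs (\<lambda>i. representation (set xs) z (xs ! i)) = z"
    using sp by (simp add: lin_sum_set[OF dist] sum_representation_eq[OF ind])
  then have "z - lin_sum scale xs (\<lambda>i. representation (set xs) z (xs ! i)) \<in> {0}" by simp
  then show "\<exists>a. z - lin_sum scale xs a \<in> {0}" by blast
next
  fix a i assume "lin_sum scale xs a \<in> {0}" "i < length xs"
  then show "a i = 0"
    using representation_lin_sum[OF xs, of i a] by (simp add: representation_zero)
qed

lemma base_change_det_transition:
  assumes cs: "ordered_basis scale V cs" and M: "transition scale {0} cs bs M"
  shows "base_change_det scale bs cs = Determinant.det M"
proof -
  have "Matrix.mat (length cs) (length cs) (\<lambda>(j, i). representation (set cs) (bs ! i) (cs ! j)) = M"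
  proof (rule eq_matI)
    fix j i assume "j < dim_row M" "i < dim_col M"
    then have ji: "j < length cs" "i < length cs" using M by (auto simp: transition_def)
    then have "bs ! i = lin_sum scale cs (\<lambda>l. M $$ (l, i))"
      using M by (auto simp: transition_def)
    then show "Matrix.mat (length cs) (length cs) (\<lambda>(j, i). representation (set cs) (bs ! i) (cs ! j)) $$ (j, i) = M $$ (j, i)"
      using ji representation_lin_sum[OF cs] by simp
  qed (use M in \<open>auto simp: transition_def\<close>)
  then show ?thesis by (simp add: base_change_det_def)
qed

text \<open>Transitivity of transition matrices, with \<open>cs\<close> as the common reference basis.\<close>

lemma base_change_det_mult:
  assumes cs: "ordered_basis scale V cs" and bs: "basis_mod scale V {0} bs"
    and bs': "basis_mod scale V {0} bs'"  and M: "transition scale {0} bs bs' M"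
  shows "base_change_det scale bs' cs = base_change_det scale bs cs * Determinant.det M"
    and "base_change_det scale bs cs \<noteq> 0"
proof -
  have 0: "subspace {0}" by simp
  have c: "basis_mod scale V {0} cs" by (rule ordered_basis_imp_basis_mod[OF cs])
  obtain N where N: "transition scale {0} cs bs N"
    using transition_exists[OF c, of bs] bs basis_mod_length_eq[OF 0 c bs] by (auto simp: basis_mod_def)
  have carr: "N \<in> carrier_mat (length cs) (length cs)" "M \<in> carrier_mat (length cs) (length cs)"
    using N M by (auto simp: transition_def)
  show "base_change_det scale bs' cs = base_change_det scale bs cs * Determinant.det M"
    using base_change_det_transition[OF cs transition_trans[OF 0 N M]] base_change_det_transition[OF cs N]
      det_mult[OF carr] by simp
  show "base_change_det scale bs cs \<noteq> 0"
    using transition_det_nonzero[OF 0 c bs N] base_change_det_transition[OF cs N] by simp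
qed

lemma ordered_basis_zero_space:
  assumes "ordered_basis scale {0} b" shows "b = []"
proof -
  have "basis_mod scale {0} {0} b" using ordered_basis_imp_basis_mod[OF assms] .
  moreover from this have "lin_sum scale b (\<lambda>_. 1) \<in> {0}"
    using lin_sum_in[of "{0}" b] by (auto simp: basis_mod_def)
  ultimately have "\<forall>i<length b. (1::'a) = 0" by (auto simp: basis_mod_def)
  then show ?thesis by auto
qed

end

definition represents :: "'v set list \<Rightarrow> 'v list \<Rightarrow> bool" where
  "represents hs xs \<longleftrightarrow> length xs = length hs \<and> (\<forall>a<length hs. xs ! a \<in> hs ! a)"

context vector_space
begin

lemma qclass_eq_iff:
  assumes "subspace B" shows "qclass B x = qclass B y \<longleftrightarrow> x - y \<in> B"
proof
  assume "qclass B x = qclass B y"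
  moreover have "x \<in> qclass B x" using subspace_0[OF assms] unfolding qclass_def by force
  ultimately obtain b where "x = y + b" "b \<in> B" by (auto simp: qclass_def)
  then show "x - y \<in> B" by simp
next
  have *: "qclass B x \<subseteq> qclass B y" if "x - y \<in> B" for x y
  proof
    fix w assume "w \<in> qclass B x"
    then obtain b where "w = x + b" "b \<in> B" by (auto simp: qclass_def)
    then have "w = y + ((x - y) + b)" "(x - y) + b \<in> B"
      using that subspace_add[OF assms] by auto
    then show "w \<in> qclass B y" unfolding qclass_def by blast
  qed
  assume xy: "x - y \<in> B"
  then have "y - x \<in> B" using subspace_neg[OF assms xy] by simp
  then show "qclass B x = qclass B y" using * xy by blast
qed

lemma in_qclass_iff: "z \<in> qclass B x \<longleftrightarrow> z - x \<in> B"
  unfolding qclass_def by (auto, metis add.commute diff_add_cancel)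

lemma lin_sum_diff_mod:
  assumes B: "subspace B" and len: "length ys = length xs"
    and "\<And>i. i < length xs \<Longrightarrow> ys ! i - xs ! i \<in> B"
  shows "lin_sum scale ys a - lin_sum scale xs a \<in> B"
proof -
  have "lin_sum scale ys a - lin_sum scale xs a = (\<Sum>i<length xs. scale (a i) (ys ! i - xs ! i))"
    using len by (simp add: lin_sum_def scale_right_diff_distrib sum_subtractf)
  then show ?thesis using assms by (auto intro!: subspace_sum subspace_scale)
qed

text \<open>Representatives of the classes in \<open>hs\<close> may be changed by elements of \<open>B\<close> only, so any choice of
  them is again a basis modulo \<open>B\<close>.\<close>

lemma quotient_basis_represents:
  assumes B: "subspace B" and Z: "subspace Z" "B \<subseteq> Z" and hs: "quotient_basis scale Z B hs"
    and ys: "represents hs ys"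
  shows "basis_mod scale Z B ys" and "hs = map (qclass B) ys"
proof -
  obtain xs where xs: "set xs \<subseteq> Z" "hs = map (qclass B) xs"
    "\<And>z. z \<in> Z \<Longrightarrow> \<exists>!a. length a = length xs \<and>
            qclass B z = qclass B (\<Sum>k<length xs. scale (a ! k) (xs ! k))"
    using hs by (auto simp: quotient_basis_def)
  have len: "length ys = length xs" using ys xs by (simp add: represents_def)
  have d: "ys ! i - xs ! i \<in> B" if "i < length xs" for i
    using ys xs(2) that by (simp add: represents_def in_qclass_iff)
  have "qclass B (ys ! i) = qclass B (xs ! i)" if "i < length xs" for i
    using d[OF that] by (simp add: qclass_eq_iff[OF B])
  then show "hs = map (qclass B) ys"
    using xs(2) len by (intro nth_equalityI) auto
  have lin: "lin_sum scale ys a - lin_sum scale xs a \<in> B" for a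
    using lin_sum_diff_mod[OF B len d] .
  show "basis_mod scale Z B ys"
    unfolding basis_mod_def
  proof (intro conjI ballI allI impI)
    show "set ys \<subseteq> Z"
    proof
      fix y assume "y \<in> set ys"
      then obtain i where i: "i < length xs" "y = ys ! i" using len by (auto simp: in_set_conv_nth)
      have "xs ! i + (ys ! i - xs ! i) \<in> Z"
        using i xs(1) d Z by (intro subspace_add) auto
      then show "y \<in> Z" using i by simp
    qed
    fix z assume "z \<in> Z"
    then obtain a where "qclass B z = qclass B (\<Sum>k<length xs. scale (a ! k) (xs ! k))"
      using xs(3) by blast
    then have "z - lin_sum scale xs (\<lambda>i. a ! i) \<in> B" by (simp add: qclass_eq_iff[OF B] lin_sum_def)
    then have "z - lin_sum scale ys (\<lambda>i. a ! i) \<in> B"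
      using subspace_diff[OF B _ lin, of "z - lin_sum scale xs (\<lambda>i. a ! i)" "\<lambda>i. a ! i"] by simp
    then show "\<exists>a. z - lin_sum scale ys a \<in> B" by blast
  next
    fix a i assume a: "lin_sum scale ys a \<in> B" and i: "i < length ys"
    have "lin_sum scale xs a \<in> B" using subspace_diff[OF B a lin[of a]] by simp
    then have "qclass B (lin_sum scale xs a) = qclass B 0" by (simp add: qclass_eq_iff[OF B])
    then have "qclass B 0 = qclass B (\<Sum>k<length xs. scale (map a [0..<length xs] ! k) (xs ! k))"
      by (simp add: lin_sum_def)
    moreover have "qclass B 0 = qclass B (\<Sum>k<length xs. scale (replicate (length xs) 0 ! k) (xs ! k))"
      by simp
    moreover have "length (map a [0..<length xs]) = length xs" "length (replicate (length xs) (0::'a)) = length xs"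
      by simp_all
    ultimately have "map a [0..<length xs] = replicate (length xs) 0"
      using xs(3)[OF subspace_0[OF Z(1)]] by blast
    then have "map a [0..<length xs] ! i = 0" using i len by simp
    then show "a i = 0" using i len by simp
  qed
qed

lemma quotient_basis_represents_exists:
  assumes B: "subspace B" and hs: "quotient_basis scale Z B hs"
  obtains ys where "represents hs ys"
proof -
  obtain xs where "hs = map (qclass B) xs"
    using hs by (auto simp: quotient_basis_def)
  then have "represents hs xs"
    using subspace_0[OF B] by (auto simp: represents_def in_qclass_iff)
  then show thesis by (rule that)
qed

text \<open>Because \<open>f\<close> induces an isomorphism from \<open>C / ker f\<close> to \<open>f ` C\<close>, lifts of a basis of the image form a
  basis of \<open>C\<close> modulo the kernel, and two such lifts are related by the same matrix as their images.\<close>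

lemma lift_basis_mod_kernel:
  assumes add: "\<And>x y. f (x + y) = f x + f y" and sc: "\<And>a x. f (scale a x) = scale a (f x)"
    and C: "subspace C" and bt: "set bt \<subseteq> C" and b: "basis_mod scale (f ` C) {0} (map f bt)"
  shows "basis_mod scale C {x \<in> C. f x = 0} bt"
    and "\<lbrakk>transition scale {0} (map f bt) (map f bt') M; set bt' \<subseteq> C\<rbrakk> \<Longrightarrow>
           transition scale {x \<in> C. f x = 0} bt bt' M"
proof -
  have f0: "f 0 = 0" using add[of 0 0] by simp
  have fdiff: "f (x - y) = f x - f y" for x y using add[of "x - y" y] by (simp add: algebra_simps)
  have fsum: "f (sum g S) = (\<Sum>x\<in>S. f (g x))" for g and S :: "nat set"
    by (induction S rule: infinite_finite_induct) (auto simp: f0 add)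
  have flin: "f (lin_sum scale bt a) = lin_sum scale (map f bt) a" for a
    by (simp add: lin_sum_def fsum sc)
  have linC: "lin_sum scale bt a \<in> C" for a by (rule lin_sum_in[OF C bt])
  show "basis_mod scale C {x \<in> C. f x = 0} bt"
    unfolding basis_mod_def
  proof (intro conjI ballI allI impI)
    fix z assume z: "z \<in> C"
    then obtain a where "f z - lin_sum scale (map f bt) a \<in> {0}" using b by (auto simp: basis_mod_def)
    then have "z - lin_sum scale bt a \<in> {x \<in> C. f x = 0}"
      using z linC subspace_diff[OF C] by (auto simp: fdiff flin)
    then show "\<exists>a. z - lin_sum scale bt a \<in> {x \<in> C. f x = 0}" by blast
  next
    fix a i assume "lin_sum scale bt a \<in> {x \<in> C. f x = 0}" "i < length bt"
    then show "a i = 0" using b by (auto simp: basis_mod_def flin)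
  qed (rule bt)
  show "transition scale {x \<in> C. f x = 0} bt bt' M"
    if M: "transition scale {0} (map f bt) (map f bt') M" and bt': "set bt' \<subseteq> C"
    unfolding transition_def
  proof (intro conjI allI impI)
    show len: "length bt' = length bt" using M by (simp add: transition_def)
    show "M \<in> carrier_mat (length bt) (length bt)" using M by (simp add: transition_def)
    fix j assume j: "j < length bt"
    have "bt' ! j \<in> C" using j len bt' by auto
    then show "bt' ! j - lin_sum scale bt (\<lambda>i. M $$ (i, j)) \<in> {x \<in> C. f x = 0}"
      using M j len linC subspace_diff[OF C] by (auto simp: transition_def fdiff flin)
  qed
qed

end

section \<open>Torsion of a based complex under a change of cohomology bases\<close>

text \<open>The auxiliary data in the definition of the torsion and the value that they give are separated, so
  that the values for two sets of data can be compared.\<close>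

definition torsion_choice ::
    "('k::field \<Rightarrow> 'v::ab_group_add \<Rightarrow> 'v) \<Rightarrow> nat \<Rightarrow> (nat \<Rightarrow> 'v set) \<Rightarrow> (nat \<Rightarrow> 'v \<Rightarrow> 'v) \<Rightarrow>
     (nat \<Rightarrow> 'v set list) \<Rightarrow> (nat \<Rightarrow> 'v list) \<Rightarrow> (nat \<Rightarrow> 'v list) \<Rightarrow> (nat \<Rightarrow> 'v list) \<Rightarrow> bool" where
  "torsion_choice s k C \<delta> h b bt ht \<longleftrightarrow>
     (\<forall>i\<le>Suc k. ordered_basis s (coboundaries C \<delta> i) (b i)) \<and>
     (\<forall>i\<le>k. set (bt (Suc i)) \<subseteq> C i \<and> map (\<delta> i) (bt (Suc i)) = b (Suc i)) \<and>
     (\<forall>i\<le>k. represents (h i) (ht i))"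

definition torsion_value ::
    "('k::field \<Rightarrow> 'v::ab_group_add \<Rightarrow> 'v) \<Rightarrow> nat \<Rightarrow> (nat \<Rightarrow> 'v list) \<Rightarrow>
     (nat \<Rightarrow> 'v list) \<Rightarrow> (nat \<Rightarrow> 'v list) \<Rightarrow> (nat \<Rightarrow> 'v list) \<Rightarrow> 'k" where
  "torsion_value s k c b bt ht =
     (\<Prod>i\<le>k. base_change_det s (b i @ ht i @ bt (Suc i)) (c i) powi ((-1) ^ Suc i))"

lemma is_torsion_choice:
  "is_torsion s k C \<delta> c h t \<longleftrightarrow> (\<exists>b bt ht. torsion_choice s k C \<delta> h b bt ht \<and> t = torsion_value s k c b bt ht)"
  unfolding is_torsion_def torsion_choice_def torsion_value_def represents_def by (simp add: conj_assoc)

text \<open>Each \<open>p (i + 1)\<close> occurs in degrees \<open>i\<close> and \<open>i + 1\<close>, with opposite exponents.  Here \<open>p i\<close> will be the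
  determinant of a change of basis of the coboundaries of degree \<open>i\<close>.\<close>

lemma alternating_product_telescopes:
  fixes p :: "nat \<Rightarrow> 'a::field"
  assumes "\<And>i. i \<le> Suc k \<Longrightarrow> p i \<noteq> 0"
  shows "(\<Prod>i\<le>k. (p i * p (Suc i)) powi ((-1) ^ Suc i)) = inverse (p 0) * p (Suc k) powi ((-1) ^ Suc k)"
  using assms
proof (induction k)
  case 0
  then show ?case by (simp add: power_int_minus)
next
  case (Suc k)
  have "p (Suc k) powi ((-1) ^ Suc k) * p (Suc k) powi ((-1) ^ Suc (Suc k)) = 1"
    using Suc.prems[of "Suc k"] by (simp add: power_int_minus)
  then show ?case
    using Suc.IH Suc.prems by (simp add: power_int_mult_distrib mult.assoc del: power_Suc)
qed

text \<open>The coboundary vanishes in the top degree \<open>k\<close>, so that the determinants of the base changes of the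
  coboundaries cancel completely in the torsion.\<close>

locale based_complex = vector_space scale
  for scale :: "'k::field \<Rightarrow> 'v::ab_group_add \<Rightarrow> 'v" +
  fixes k :: nat and C :: "nat \<Rightarrow> 'v set" and \<delta> :: "nat \<Rightarrow> 'v \<Rightarrow> 'v" and c :: "nat \<Rightarrow> 'v list"
  assumes cochain_basis: "i \<le> k \<Longrightarrow> ordered_basis scale (C i) (c i)"
    and coboundary_add: "\<delta> i (x + y) = \<delta> i x + \<delta> i y"
    and coboundary_scale: "\<delta> i (scale a x) = scale a (\<delta> i x)"
    and coboundary_in: "i < k \<Longrightarrow> x \<in> C i \<Longrightarrow> \<delta> i x \<in> C (Suc i)"
    and coboundary_coboundary: "i < k \<Longrightarrow> x \<in> C i \<Longrightarrow> \<delta> (Suc i) (\<delta> i x) = 0"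
    and coboundary_top: "x \<in> C k \<Longrightarrow> \<delta> k x = 0"
begin

lemma subspace_cochains: "i \<le> k \<Longrightarrow> subspace (C i)"
  using cochain_basis ordered_basis_subspace by blast

lemma coboundary_zero: "\<delta> i 0 = 0"
  using coboundary_add[of i 0 0] by simp

lemma subspace_cocycles: "i \<le> k \<Longrightarrow> subspace (cocycles C \<delta> i)"
  using subspace_cochains[of i]
  by (auto simp: cocycles_def subspace_def coboundary_add coboundary_scale coboundary_zero)

lemma subspace_coboundaries: "i \<le> Suc k \<Longrightarrow> subspace (coboundaries C \<delta> i)"
proof (cases i)
  case (Suc j)
  assume "i \<le> Suc k"
  then have C: "subspace (C j)" using subspace_cochains Suc by simp
  show ?thesis
    unfolding Suc coboundaries_def subspace_def nat.case
  proof (intro conjI ballI allI)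
    show "0 \<in> \<delta> j ` C j" using coboundary_zero[of j] subspace_0[OF C] by force
    fix x assume "x \<in> \<delta> j ` C j"
    then obtain x' where x: "x = \<delta> j x'" "x' \<in> C j" by auto
    show "scale a x \<in> \<delta> j ` C j" for a
      using x subspace_scale[OF C] by (auto simp: coboundary_scale[symmetric])
    fix y assume "y \<in> \<delta> j ` C j"
    then obtain y' where y: "y = \<delta> j y'" "y' \<in> C j" by auto
    show "x + y \<in> \<delta> j ` C j"
      using x y subspace_add[OF C] by (auto simp: coboundary_add[symmetric])
  qed
qed (simp add: coboundaries_def)

lemma coboundaries_subset_cocycles: "i \<le> k \<Longrightarrow> coboundaries C \<delta> i \<subseteq> cocycles C \<delta> i"
  using coboundary_in coboundary_coboundary subspace_0[OF subspace_cochains] coboundary_zero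
  by (auto simp: coboundaries_def cocycles_def split: nat.splits)

lemma coboundaries_zero: "coboundaries C \<delta> 0 = {0}"
  by (simp add: coboundaries_def)

lemma coboundaries_top: "coboundaries C \<delta> (Suc k) = {0}"
  using coboundary_top coboundary_zero subspace_0[OF subspace_cochains]
  by (fastforce simp: coboundaries_def)

lemma torsion_choice_bases:
  assumes ch: "torsion_choice scale k C \<delta> h b bt ht" and h: "\<forall>i\<le>k. cohomology_basis scale C \<delta> i (h i)"
    and i: "i \<le> k"
  shows "basis_mod scale (coboundaries C \<delta> i) {0} (b i)"
    and "basis_mod scale (cocycles C \<delta> i) (coboundaries C \<delta> i) (ht i)"
    and "basis_mod scale (C i) (cocycles C \<delta> i) (bt (Suc i))"
    and "basis_mod scale (C i) (coboundaries C \<delta> i) (ht i @ bt (Suc i))"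
    and "basis_mod scale (C i) {0} (b i @ ht i @ bt (Suc i))"
proof -
  have ob: "\<And>i. i \<le> Suc k \<Longrightarrow> ordered_basis scale (coboundaries C \<delta> i) (b i)"
    using ch by (simp add: torsion_choice_def)
  show b: "basis_mod scale (coboundaries C \<delta> i) {0} (b i)"
    using ob i by (intro ordered_basis_imp_basis_mod) auto
  show z: "basis_mod scale (cocycles C \<delta> i) (coboundaries C \<delta> i) (ht i)"
    using ch h[rule_format, OF i] i unfolding cohomology_basis_def torsion_choice_def
    by (intro quotient_basis_represents(1) subspace_coboundaries subspace_cocycles coboundaries_subset_cocycles) auto
  have "basis_mod scale (\<delta> i ` C i) {0} (map (\<delta> i) (bt (Suc i)))"
    using ordered_basis_imp_basis_mod[OF ob[of "Suc i"]] ch i by (simp add: torsion_choice_def coboundaries_def)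
  then show t: "basis_mod scale (C i) (cocycles C \<delta> i) (bt (Suc i))"
    unfolding cocycles_def using ch i
    by (intro lift_basis_mod_kernel coboundary_add coboundary_scale subspace_cochains)
      (auto simp: torsion_choice_def)
  have sub: "cocycles C \<delta> i \<subseteq> C i" by (auto simp: cocycles_def)
  show zt: "basis_mod scale (C i) (coboundaries C \<delta> i) (ht i @ bt (Suc i))"
    using i by (intro basis_mod_append[OF _ sub _ z t] subspace_cocycles coboundaries_subset_cocycles)
  show "basis_mod scale (C i) {0} (b i @ ht i @ bt (Suc i))"
    using coboundaries_subset_cocycles[OF i] sub i subspace_0[OF subspace_coboundaries[of i]]
    by (intro basis_mod_append[OF _ _ _ b zt] subspace_coboundaries) auto
qed

text \<open>In degree \<open>i\<close> the two adapted bases are \<open>b i @ ht i @ bt (Suc i)\<close> and its primed version.  Their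
  transition matrix is block triangular with respect to \<open>0 \<subseteq> B\<^sup>i \<subseteq> Z\<^sup>i \<subseteq> C\<^sup>i\<close>, with diagonal blocks
  \<open>P i\<close>, \<open>A i\<close> and \<open>P (Suc i)\<close>: the last block is the transition between the bases of the next
  coboundaries.  The factors \<open>det (P i)\<close> cancel in the alternating product.\<close>

lemma torsion_value_change:
  assumes ch: "torsion_choice scale k C \<delta> h b bt ht" and h: "\<forall>i\<le>k. cohomology_basis scale C \<delta> i (h i)"
    and ch': "torsion_choice scale k C \<delta> h' b' bt' ht'" and h': "\<forall>i\<le>k. cohomology_basis scale C \<delta> i (h' i)"
    and A: "\<forall>i\<le>k. transition scale (coboundaries C \<delta> i) (ht i) (ht' i) (A i)"
  shows "torsion_value scale k c b' bt' ht' =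
     torsion_value scale k c b bt ht * (\<Prod>i\<le>k. Determinant.det (A i) powi ((-1) ^ Suc i))"
    and "torsion_value scale k c b bt ht \<noteq> 0"
proof -
  have 0: "subspace {0}" by simp
  note bas = torsion_choice_bases[OF ch h] and bas' = torsion_choice_bases[OF ch' h']
  have ob: "\<And>i. i \<le> Suc k \<Longrightarrow> ordered_basis scale (coboundaries C \<delta> i) (b i)"
    and ob': "\<And>i. i \<le> Suc k \<Longrightarrow> ordered_basis scale (coboundaries C \<delta> i) (b' i)"
    using ch ch' by (auto simp: torsion_choice_def)
  have "\<exists>P. transition scale {0} (b i) (b' i) P" if "i \<le> Suc k" for i
    using transition_exists ordered_basis_imp_basis_mod[OF ob] ordered_basis_imp_basis_mod[OF ob']
      basis_mod_length_eq[OF 0] that unfolding basis_mod_def by metis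
  then obtain P where P: "\<And>i. i \<le> Suc k \<Longrightarrow> transition scale {0} (b i) (b' i) (P i)"
    by metis
  define p where "p i = Determinant.det (P i)" for i
  have p0: "p i \<noteq> 0" if "i \<le> Suc k" for i
    unfolding p_def
    by (rule transition_det_nonzero[OF 0 ordered_basis_imp_basis_mod[OF ob[OF that]]
        ordered_basis_imp_basis_mod[OF ob'[OF that]] P[OF that]])
  \<comment> \<open>The coboundaries vanish in degrees \<open>0\<close> and \<open>Suc k\<close>, where \<open>P i\<close> is the empty matrix.\<close>
  have p1: "p i = 1" if "coboundaries C \<delta> i = {0}" "i \<le> Suc k" for i
  proof -
    have "b i = []" using ob[of i] that ordered_basis_zero_space by simp
    then have "P i \<in> carrier_mat 0 0" using P[OF that(2)] by (simp add: transition_def)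
    then show ?thesis unfolding p_def by (rule det_dim_zero)
  qed
  let ?L = "\<lambda>i. b i @ ht i @ bt (Suc i)" and ?L' = "\<lambda>i. b' i @ ht' i @ bt' (Suc i)"
  have deg: "base_change_det scale (?L' i) (c i) =
      base_change_det scale (?L i) (c i) * Determinant.det (A i) * (p i * p (Suc i))"
    "base_change_det scale (?L i) (c i) \<noteq> 0" if i: "i \<le> k" for i
  proof -
    have bt: "set (bt (Suc i)) \<subseteq> C i" "map (\<delta> i) (bt (Suc i)) = b (Suc i)"
      "set (bt' (Suc i)) \<subseteq> C i" "map (\<delta> i) (bt' (Suc i)) = b' (Suc i)"
      using ch ch' i by (auto simp: torsion_choice_def)
    have Pt: "transition scale (cocycles C \<delta> i) (bt (Suc i)) (bt' (Suc i)) (P (Suc i))"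
      unfolding cocycles_def
    proof (rule lift_basis_mod_kernel(2)[where f = "\<delta> i"])
      show "basis_mod scale (\<delta> i ` C i) {0} (map (\<delta> i) (bt (Suc i)))"
        using ordered_basis_imp_basis_mod[OF ob[of "Suc i"]] bt i by (simp add: coboundaries_def)
      show "transition scale {0} (map (\<delta> i) (bt (Suc i))) (map (\<delta> i) (bt' (Suc i))) (P (Suc i))"
        using P[of "Suc i"] bt i by simp
    qed (use bt i coboundary_add coboundary_scale subspace_cochains in auto)
    obtain M where M: "transition scale (coboundaries C \<delta> i) (ht i @ bt (Suc i)) (ht' i @ bt' (Suc i)) M"
        "Determinant.det M = Determinant.det (A i) * p (Suc i)"
      unfolding p_def
      by (rule transition_append[OF subspace_coboundaries bas(2)[OF i] A[rule_format, OF i] Pt])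
        (use i in auto)
    obtain N where N: "transition scale {0} (?L i) (?L' i) N"
        "Determinant.det N = p i * (Determinant.det (A i) * p (Suc i))"
      unfolding p_def
      by (rule transition_append[OF 0 bas(1)[OF i] P M(1)]) (use i M(2) in \<open>auto simp: p_def\<close>)
    show "base_change_det scale (?L' i) (c i) =
      base_change_det scale (?L i) (c i) * Determinant.det (A i) * (p i * p (Suc i))"
      using base_change_det_mult(1)[OF cochain_basis[OF i] bas(5)[OF i] bas'(5)[OF i] N(1)] N(2)
      by (simp add: mult_ac)
    show "base_change_det scale (?L i) (c i) \<noteq> 0"
      using base_change_det_mult(2)[OF cochain_basis[OF i] bas(5)[OF i] bas'(5)[OF i] N(1)] .
  qed
  show "torsion_value scale k c b bt ht \<noteq> 0"
    using deg(2) by (simp add: torsion_value_def)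
  have "torsion_value scale k c b' bt' ht' =
      torsion_value scale k c b bt ht * (\<Prod>i\<le>k. Determinant.det (A i) powi ((-1) ^ Suc i)) *
      (\<Prod>i\<le>k. (p i * p (Suc i)) powi ((-1) ^ Suc i))"
    unfolding torsion_value_def prod.distrib[symmetric]
    by (intro prod.cong refl) (simp add: deg(1) power_int_mult_distrib del: power_Suc)
  also have "(\<Prod>i\<le>k. (p i * p (Suc i)) powi ((-1) ^ Suc i)) = 1"
    using alternating_product_telescopes[of k p, OF p0] p1[OF coboundaries_zero] p1[OF coboundaries_top] by simp
  finally show "torsion_value scale k c b' bt' ht' =
     torsion_value scale k c b bt ht * (\<Prod>i\<le>k. Determinant.det (A i) powi ((-1) ^ Suc i))" by simp
qed

lemma torsion_choice_exists:
  assumes ht: "\<forall>i\<le>k. represents (h i) (ht i)"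
  obtains b bt where "torsion_choice scale k C \<delta> h b bt ht"
proof -
  have "\<exists>bs. ordered_basis scale (coboundaries C \<delta> i) bs" if i: "i \<le> Suc k" for i
  proof -
    let ?B = "coboundaries C \<delta> i"
    obtain S where S: "S \<subseteq> ?B" "independent S" "?B \<subseteq> span S"
      using maximal_independent_subset[of ?B] by blast
    have "?B \<subseteq> {0} \<or> (\<exists>j\<le>k. ?B \<subseteq> C j)"
    proof (cases "i \<le> k")
      case True
      then show ?thesis using coboundaries_subset_cocycles[OF True] by (auto simp: cocycles_def)
    next
      case False
      then have "i = Suc k" using i by simp
      then show ?thesis using coboundaries_top by simp
    qed
    then have "finite S"
    proof
      assume "?B \<subseteq> {0}"
      then show ?thesis using S(1) by (meson finite.emptyI finite_insert finite_subset)
    next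
      assume "\<exists>j\<le>k. ?B \<subseteq> C j"
      then obtain j where "j \<le> k" "?B \<subseteq> C j" by blast
      then have "S \<subseteq> span (set (c j))"
        using S(1) cochain_basis[of j] by (auto simp: ordered_basis_def)
      then show ?thesis using independent_span_bound[OF _ S(2)] by blast
    qed
    then obtain bs where bs: "set bs = S" "distinct bs" using finite_distinct_list by blast
    have "span S = ?B" using S subspace_coboundaries[OF i] by (metis span_subspace)
    then show ?thesis using bs S(2) by (auto simp: ordered_basis_def)
  qed
  then obtain b where b: "\<And>i. i \<le> Suc k \<Longrightarrow> ordered_basis scale (coboundaries C \<delta> i) (b i)"
    by metis
  have "\<exists>t. set t \<subseteq> C i \<and> map (\<delta> i) t = b (Suc i)" if "i \<le> k" for i
  proof -
    have "set (b (Suc i)) \<subseteq> \<delta> i ` C i"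
      using ordered_basis_imp_basis_mod[OF b[of "Suc i"]] that by (simp add: basis_mod_def coboundaries_def)
    then have "set (map (inv_into (C i) (\<delta> i)) (b (Suc i))) \<subseteq> C i"
      "map (\<delta> i) (map (inv_into (C i) (\<delta> i)) (b (Suc i))) = b (Suc i)"
      by (auto simp: inv_into_into subset_iff f_inv_into_f intro!: map_idI)
    then show ?thesis by blast
  qed
  then obtain t where t: "\<And>i. i \<le> k \<Longrightarrow> set (t i) \<subseteq> C i \<and> map (\<delta> i) (t i) = b (Suc i)" by metis
  \<comment> \<open>The lifts of \<open>b (Suc i)\<close> are indexed by \<open>Suc i\<close>, although they lie in degree \<open>i\<close>.\<close>
  have "torsion_choice scale k C \<delta> h b (\<lambda>i. t (i - 1)) ht"
    unfolding torsion_choice_def using b t ht by simp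
  then show thesis by (rule that)
qed

text \<open>Two choices for the same cohomology bases differ by identity matrices on cohomology, so their values
  agree.  Hence the torsion is well defined.\<close>

lemma torsion_eq_value:
  assumes ch: "torsion_choice scale k C \<delta> h b bt ht" and h: "\<forall>i\<le>k. cohomology_basis scale C \<delta> i (h i)"
  shows "torsion scale k C \<delta> c h = torsion_value scale k c b bt ht"
  unfolding torsion_def is_torsion_choice
proof (rule the_equality)
  fix t assume "\<exists>b bt ht. torsion_choice scale k C \<delta> h b bt ht \<and> t = torsion_value scale k c b bt ht"
  then obtain b' bt' ht' where ch': "torsion_choice scale k C \<delta> h b' bt' ht'"
    and t: "t = torsion_value scale k c b' bt' ht'" by blast
  have A: "\<forall>i\<le>k. transition scale (coboundaries C \<delta> i) (ht i) (ht' i) (1\<^sub>m (length (ht i)))"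
  proof (intro allI impI transition_one)
    fix i assume i: "i \<le> k"
    have r: "represents (h i) (ht i)" "represents (h i) (ht' i)"
      using ch ch' i by (auto simp: torsion_choice_def)
    show "length (ht' i) = length (ht i)" using r by (simp add: represents_def)
    fix j assume j: "j < length (ht i)"
    have "h i = map (qclass (coboundaries C \<delta> i)) (ht i)"
      using h[rule_format, OF i] i r unfolding cohomology_basis_def
      by (intro quotient_basis_represents(2)[of _ "cocycles C \<delta> i"] subspace_coboundaries
          subspace_cocycles coboundaries_subset_cocycles) auto
    then show "ht' i ! j - ht i ! j \<in> coboundaries C \<delta> i"
      using r j by (auto simp: represents_def in_qclass_iff)
  qed
  show "t = torsion_value scale k c b bt ht"
    using torsion_value_change(1)[OF ch h ch' h A] t by simp
qed (use ch in blast)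

theorem torsion_change:
  assumes h: "\<forall>i\<le>k. cohomology_basis scale C \<delta> i (h i)"
    and h': "\<forall>i\<le>k. cohomology_basis scale C \<delta> i (h' i)"
    and ht: "\<forall>i\<le>k. represents (h i) (ht i)" and ht': "\<forall>i\<le>k. represents (h' i) (ht' i)"
    and A: "\<forall>i\<le>k. transition scale (coboundaries C \<delta> i) (ht i) (ht' i) (A i)"
  shows "torsion scale k C \<delta> c h' =
      torsion scale k C \<delta> c h * (\<Prod>i\<le>k. Determinant.det (A i) powi ((-1) ^ Suc i))"
    and "torsion scale k C \<delta> c h \<noteq> 0"
proof -
  obtain b bt where ch: "torsion_choice scale k C \<delta> h b bt ht"
    using torsion_choice_exists[of h ht, OF ht] by blast
  obtain b' bt' where ch': "torsion_choice scale k C \<delta> h' b' bt' ht'"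
    using torsion_choice_exists[of h' ht', OF ht'] by blast
  show "torsion scale k C \<delta> c h' =
      torsion scale k C \<delta> c h * (\<Prod>i\<le>k. Determinant.det (A i) powi ((-1) ^ Suc i))"
    using torsion_value_change(1)[OF ch h ch' h' A] torsion_eq_value[OF ch h] torsion_eq_value[OF ch' h'] by simp
  show "torsion scale k C \<delta> c h \<noteq> 0"
    using torsion_value_change(2)[OF ch h ch' h' A] torsion_eq_value[OF ch h] by simp
qed

end

section \<open>Base changes of dual bases\<close>

lemma involution_comm_ring_hom:
  assumes "field_involution \<iota>" shows "comm_ring_hom \<iota>"
proof -
  have "\<iota> 0 = \<iota> (0 + 0)" by simp
  also have "\<dots> = \<iota> 0 + \<iota> 0" using assms unfolding field_involution_def by blast
  finally have "\<iota> 0 = 0" by (simp only: add_cancel_right_right)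
  then show ?thesis using assms by unfold_locales (auto simp: field_involution_def)
qed

context vector_space
begin

text \<open>Expanding the pairing of the new bases in terms of the old dual bases gives
  \<open>\<sigma>(A)\<^sup>T \<tau>(D) = 1\<close>.  The two homomorphisms are the identity and the involution, in either order, since
  either variable of a sesquilinear pairing may be the linear one.\<close>

lemma biadditive_pairing_det:
  fixes P :: "'b set \<Rightarrow> 'b set \<Rightarrow> 'a"
  assumes \<sigma>: "comm_ring_hom \<sigma>" and \<tau>: "comm_ring_hom \<tau>"
    and Z: "subspace Z" "subspace Z'" and B: "subspace B" "subspace B'"
    and add_left: "\<And>x x' y. x \<in> Z \<Longrightarrow> x' \<in> Z \<Longrightarrow> y \<in> Z' \<Longrightarrow>
        P (qclass B (x + x')) (qclass B' y) = P (qclass B x) (qclass B' y) + P (qclass B x') (qclass B' y)"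
    and add_right: "\<And>x y y'. x \<in> Z \<Longrightarrow> y \<in> Z' \<Longrightarrow> y' \<in> Z' \<Longrightarrow>
        P (qclass B x) (qclass B' (y + y')) = P (qclass B x) (qclass B' y) + P (qclass B x) (qclass B' y')"
    and scale_left: "\<And>a x y. x \<in> Z \<Longrightarrow> y \<in> Z' \<Longrightarrow>
        P (qclass B (scale a x)) (qclass B' y) = \<sigma> a * P (qclass B x) (qclass B' y)"
    and scale_right: "\<And>a x y. x \<in> Z \<Longrightarrow> y \<in> Z' \<Longrightarrow>
        P (qclass B x) (qclass B' (scale a y)) = \<tau> a * P (qclass B x) (qclass B' y)"
    and xs: "set xs \<subseteq> Z" and ys: "set ys \<subseteq> Z'"
    and A: "transition scale B xs xs' A" and D: "transition scale B' ys ys' D"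
    and dual: "dual_classes P (map (qclass B) xs) (map (qclass B') ys)"
    and dual': "dual_classes P (map (qclass B) xs') (map (qclass B') ys')"
  shows "\<sigma> (Determinant.det A) * \<tau> (Determinant.det D) = 1"
proof -
  interpret \<sigma>: comm_ring_hom \<sigma> by fact
  interpret \<tau>: comm_ring_hom \<tau> by fact
  define n where "n = length xs"
  define q where "q x y = P (qclass B x) (qclass B' y)" for x y
  have len: "length xs = n" "length ys = n" "length xs' = n" "length ys' = n"
    using A D dual by (auto simp: n_def transition_def dual_classes_def)
  have carr: "A \<in> carrier_mat n n" "D \<in> carrier_mat n n"
    using A D len by (auto simp: transition_def)
  have q0: "q 0 y = 0" if "y \<in> Z'" for y
    using add_left[of 0 0 y] that subspace_0[OF Z(1)] unfolding q_def add_0 by (simp only: add_cancel_right_right)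
  have q0': "q x 0 = 0" if "x \<in> Z" for x
    using add_right[of x 0 0] that subspace_0[OF Z(2)] unfolding q_def add_0 by (simp only: add_cancel_right_right)
  have left: "q (\<Sum>i<l. scale (a i) (xs ! i)) y = (\<Sum>i<l. \<sigma> (a i) * q (xs ! i) y)"
    if "l \<le> n" "y \<in> Z'" for l a y
    using that(1)
  proof (induction l)
    case (Suc l)
    have "(\<Sum>i<l. scale (a i) (xs ! i)) \<in> Z" "xs ! l \<in> Z"
      using Suc.prems xs len by (auto intro!: subspace_sum subspace_scale Z)
    then show ?case
      using Suc that(2) by (simp add: q_def add_left scale_left subspace_scale[OF Z(1)])
  qed (use q0 that in simp)
  have right: "q x (\<Sum>i<l. scale (a i) (ys ! i)) = (\<Sum>i<l. \<tau> (a i) * q x (ys ! i))"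
    if "l \<le> n" "x \<in> Z" for l a x
    using that(1)
  proof (induction l)
    case (Suc l)
    have "(\<Sum>i<l. scale (a i) (ys ! i)) \<in> Z'" "ys ! l \<in> Z'"
      using Suc.prems ys len by (auto intro!: subspace_sum subspace_scale Z)
    then show ?case
      using Suc that(2) by (simp add: q_def add_right scale_right subspace_scale[OF Z(2)])
  qed (use q0' that in simp)
  have dq: "q (xs ! i) (ys ! j) = (if i = j then 1 else 0)" if "i < n" "j < n" for i j
    using dual that len by (auto simp: dual_classes_def q_def)
  have entry: "(\<Sum>i<n. \<sigma> (A $$ (i, a)) * \<tau> (D $$ (i, b))) = (if a = b then 1 else 0)"
    if ab: "a < n" "b < n" for a b
  proof -
    have x: "qclass B (xs' ! a) = qclass B (lin_sum scale xs (\<lambda>i. A $$ (i, a)))"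
      using A ab len by (simp add: transition_def qclass_eq_iff[OF B(1)])
    have y: "qclass B' (ys' ! b) = qclass B' (lin_sum scale ys (\<lambda>i. D $$ (i, b)))"
      using D ab len by (simp add: transition_def qclass_eq_iff[OF B(2)])
    have "q (xs' ! a) (ys' ! b) = (if a = b then 1 else 0)"
      using dual' ab len by (simp add: q_def dual_classes_def)
    then have "(if a = b then 1 else 0) = q (lin_sum scale xs (\<lambda>i. A $$ (i, a))) (lin_sum scale ys (\<lambda>i. D $$ (i, b)))"
      by (simp only: q_def x y)
    also have "q (lin_sum scale xs (\<lambda>i. A $$ (i, a))) (lin_sum scale ys (\<lambda>i. D $$ (i, b))) =
        (\<Sum>i<n. \<sigma> (A $$ (i, a)) * q (xs ! i) (lin_sum scale ys (\<lambda>i. D $$ (i, b))))"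
      using left[OF order_refl lin_sum_in[OF Z(2) ys]] len by (simp add: lin_sum_def)
    also have "\<dots> = (\<Sum>i<n. \<sigma> (A $$ (i, a)) * (\<Sum>j<n. \<tau> (D $$ (j, b)) * q (xs ! i) (ys ! j)))"
    proof (intro sum.cong refl arg_cong2[where f = "(*)"])
      fix i assume "i \<in> {..<n}"
      then have "xs ! i \<in> Z" using xs len(1) by auto
      then show "q (xs ! i) (lin_sum scale ys (\<lambda>i. D $$ (i, b))) = (\<Sum>j<n. \<tau> (D $$ (j, b)) * q (xs ! i) (ys ! j))"
        unfolding lin_sum_def len(2) by (rule right[OF order_refl])
    qed
    also have "\<dots> = (\<Sum>i<n. \<sigma> (A $$ (i, a)) * \<tau> (D $$ (i, b)))"
    proof (intro sum.cong refl)
      fix i assume i: "i \<in> {..<n}"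
      have "(\<Sum>j<n. \<tau> (D $$ (j, b)) * q (xs ! i) (ys ! j)) = (\<Sum>j<n. if j = i then \<tau> (D $$ (j, b)) else 0)"
        using i by (intro sum.cong refl) (auto simp: dq)
      then show "\<sigma> (A $$ (i, a)) * (\<Sum>j<n. \<tau> (D $$ (j, b)) * q (xs ! i) (ys ! j)) = \<sigma> (A $$ (i, a)) * \<tau> (D $$ (i, b))"
        using i by simp
    qed
    finally show ?thesis by (rule sym)
  qed
  let ?A = "map_mat \<sigma> A" and ?D = "map_mat \<tau> D"
  have carr': "transpose_mat ?A \<in> carrier_mat n n" "?D \<in> carrier_mat n n"
    using carr by auto
  have "transpose_mat ?A * ?D = 1\<^sub>m n"
    using carr entry by (intro eq_matI) (auto simp: scalar_prod_def atLeast0LessThan)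
  then have "Determinant.det (transpose_mat ?A) * Determinant.det ?D = 1"
    using det_mult[OF carr'] by simp
  then show ?thesis
    using det_transpose[of ?A n] carr by simp
qed

text \<open>Applying the involution to \<open>det A * \<iota> (det D) = 1\<close> yields the other form of the relation, so both
  conventions for the linear variable lead to the same conclusion.\<close>

lemma sesquilinear_pairing_det:
  assumes \<iota>: "field_involution \<iota>" and P: "sesquilinear_pairing scale \<iota> Z B Z' B' P"
    and Z: "subspace Z" "subspace Z'" and B: "subspace B" "subspace B'"
    and xs: "set xs \<subseteq> Z" and ys: "set ys \<subseteq> Z'"
    and A: "transition scale B xs xs' A" and D: "transition scale B' ys ys' D"
    and dual: "dual_classes P (map (qclass B) xs) (map (qclass B') ys)"
    and dual': "dual_classes P (map (qclass B) xs') (map (qclass B') ys')"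
  shows "\<iota> (Determinant.det A) * Determinant.det D = 1"
proof -
  have inv: "\<iota> (x * y) = \<iota> x * \<iota> y" "\<iota> 1 = 1" "\<iota> (\<iota> x) = x" for x y
    using \<iota> by (auto simp: field_involution_def)
  have hom: "comm_ring_hom \<iota>" by (rule involution_comm_ring_hom[OF \<iota>])
  have id: "comm_ring_hom (\<lambda>x::'a. x)" by unfold_locales auto
  note P' = P[unfolded sesquilinear_pairing_def]
  note add_left = P'[THEN conjunct1, rule_format]
    and add_right = P'[THEN conjunct2, THEN conjunct1, rule_format]
  note scaling = P'[THEN conjunct2, THEN conjunct2]
  show ?thesis
  proof (rule disjE[OF scaling])
    assume lin: "\<forall>a. \<forall>x\<in>Z. \<forall>y\<in>Z'.
         P (qclass B (scale a x)) (qclass B' y) = a * P (qclass B x) (qclass B' y) \<and>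
         P (qclass B x) (qclass B' (scale a y)) = \<iota> a * P (qclass B x) (qclass B' y)"
    have "Determinant.det A * \<iota> (Determinant.det D) = 1"
      by (rule biadditive_pairing_det[where P = P, OF id hom Z B _ _ _ _ xs ys A D dual dual'])
        (simp_all add: add_left add_right lin)
    then have "\<iota> (Determinant.det A * \<iota> (Determinant.det D)) = 1" by (simp add: inv(2))
    then show ?thesis by (simp add: inv)
  next
    assume lin: "\<forall>a. \<forall>x\<in>Z. \<forall>y\<in>Z'.
         P (qclass B (scale a x)) (qclass B' y) = \<iota> a * P (qclass B x) (qclass B' y) \<and>
         P (qclass B x) (qclass B' (scale a y)) = a * P (qclass B x) (qclass B' y)"
    show ?thesis
      by (rule biadditive_pairing_det[where P = P, OF hom id Z B _ _ _ _ xs ys A D dual dual'])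
        (simp_all add: add_left add_right lin)
  qed
qed

end

section \<open>Norms and complementary degrees\<close>

lemma norm_set_mult:
  assumes "field_involution \<iota>" "x \<in> norm_set \<iota>" "y \<in> norm_set \<iota>"
  shows "x * y \<in> norm_set \<iota>"
proof -
  obtain a b where "x = a * \<iota> a" "y = b * \<iota> b" "a \<noteq> 0" "b \<noteq> 0"
    using assms by (auto simp: norm_set_def)
  then have "x * y = (a * b) * \<iota> (a * b) \<and> a * b \<noteq> 0"
    using assms(1) by (simp add: field_involution_def mult_ac)
  then show ?thesis unfolding norm_set_def by blast
qed

lemma norm_set_prod:
  assumes "field_involution \<iota>" "\<And>i. i \<in> S \<Longrightarrow> f i \<in> norm_set \<iota>"
  shows "prod f S \<in> norm_set \<iota>"
  using assms(2)
proof (induction S rule: infinite_finite_induct)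
  case (insert x S)
  then show ?case by (simp add: norm_set_mult[OF assms(1)])
qed (use assms(1) in \<open>auto simp: norm_set_def field_involution_def intro!: exI[of _ 1]\<close>)

text \<open>The relation says that \<open>b\<close> is the inverse of \<open>\<iota> a\<close>; opposite exponents therefore turn the product
  into \<open>a * \<iota> a\<close> or its inverse, which is the norm of the inverse of \<open>a\<close>.\<close>

lemma dual_det_quotient_in_norm_set:
  assumes \<iota>: "field_involution \<iota>" and ab: "\<iota> a * b = 1"
  shows "a powi ((-1) ^ j) * b powi (- ((-1) ^ j)) \<in> norm_set \<iota>"
proof -
  have inv: "\<iota> (x * y) = \<iota> x * \<iota> y" "\<iota> 1 = 1" "\<iota> (\<iota> x) = x" for x y
    using \<iota> by (auto simp: field_involution_def)
  interpret comm_ring_hom \<iota> by (rule involution_comm_ring_hom[OF \<iota>])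
  have a: "a \<noteq> 0" using ab by auto
  have b: "b = inverse (\<iota> a)" using ab by (metis inverse_unique)
  have ia: "\<iota> (inverse a) = inverse (\<iota> a)"
  proof -
    have "\<iota> a * \<iota> (inverse a) = 1" using a by (simp add: inv(1)[symmetric] inv(2))
    then show ?thesis by (metis inverse_unique)
  qed
  show ?thesis
  proof (cases "even j")
    case True
    then have "a powi ((-1) ^ j) * b powi (- ((-1) ^ j)) = a * \<iota> a" by (simp add: b power_int_minus)
    then show ?thesis using a by (auto simp: norm_set_def)
  next
    case False
    then have "a powi ((-1) ^ j) * b powi (- ((-1) ^ j)) = inverse a * \<iota> (inverse a)"
      by (simp add: b ia power_int_minus)
    moreover have "inverse a \<noteq> 0" using a by simp
    ultimately show ?thesis unfolding norm_set_def by blast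
  qed
qed

lemma prod_pair_complementary:
  fixes f :: "nat \<Rightarrow> 'a::comm_monoid_mult"
  shows "(\<Prod>i\<le>2 * m + 1. f i) = (\<Prod>j\<le>m. f j * f (2 * m + 1 - j))"
proof -
  have "(\<Prod>i\<le>2 * m + 1. f i) = (\<Prod>i\<in>{..m} \<union> {Suc m..2 * m + 1}. f i)"
    by (intro prod.cong) auto
  also have "\<dots> = (\<Prod>i\<le>m. f i) * (\<Prod>i\<in>{Suc m..2 * m + 1}. f i)"
    by (intro prod.union_disjoint) auto
  also have "(\<Prod>i\<in>{Suc m..2 * m + 1}. f i) = (\<Prod>j\<le>m. f (2 * m + 1 - j))"
    by (intro prod.reindex_bij_witness[of _ "\<lambda>j. 2 * m + 1 - j" "\<lambda>j. 2 * m + 1 - j"]) auto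
  finally show ?thesis by (simp add: prod.distrib)
qed

context based_complex
begin

text \<open>Since \<open>k\<close> is odd, the complementary degrees \<open>j\<close> and \<open>k - j\<close> enter the torsion with opposite exponents.
  The base changes there have determinants \<open>a\<close> and \<open>1 / \<iota> a\<close> by duality, so each pair of degrees
  contributes a norm.\<close>

theorem torsion_symmetric_family_norm:
  assumes k: "k = 2 * m + 1" and \<iota>: "field_involution \<iota>"
    and P: "\<And>j. j \<le> m \<Longrightarrow> sesquilinear_pairing scale \<iota> (cocycles C \<delta> j) (coboundaries C \<delta> j)
        (cocycles C \<delta> (k - j)) (coboundaries C \<delta> (k - j)) (P j)"
    and h: "\<And>j. j \<le> m \<Longrightarrow> cohomology_basis scale C \<delta> j (h j)"
      "\<And>j. j \<le> m \<Longrightarrow> cohomology_basis scale C \<delta> (k - j) (hdual j)"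
      "\<And>j. j \<le> m \<Longrightarrow> dual_classes (P j) (h j) (hdual j)"
    and h': "\<And>j. j \<le> m \<Longrightarrow> cohomology_basis scale C \<delta> j (h' j)"
      "\<And>j. j \<le> m \<Longrightarrow> cohomology_basis scale C \<delta> (k - j) (hdual' j)"
      "\<And>j. j \<le> m \<Longrightarrow> dual_classes (P j) (h' j) (hdual' j)"
  shows "torsion scale k C \<delta> c (symmetric_family m h hdual) \<noteq> 0"
    and "\<exists>y\<in>norm_set \<iota>. torsion scale k C \<delta> c (symmetric_family m h' hdual') =
        torsion scale k C \<delta> c (symmetric_family m h hdual) * y"
proof -
  let ?Z = "cocycles C \<delta>" and ?B = "coboundaries C \<delta>"
  let ?H = "symmetric_family m h hdual" and ?H' = "symmetric_family m h' hdual'"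
  have fam: "\<forall>i\<le>k. cohomology_basis scale C \<delta> i (symmetric_family m g gdual i)"
    if "\<And>j. j \<le> m \<Longrightarrow> cohomology_basis scale C \<delta> j (g j)"
      "\<And>j. j \<le> m \<Longrightarrow> cohomology_basis scale C \<delta> (k - j) (gdual j)" for g gdual
  proof (intro allI impI)
    fix i assume "i \<le> k"
    then show "cohomology_basis scale C \<delta> i (symmetric_family m g gdual i)"
      using that(1)[of i] that(2)[of "k - i"] by (auto simp: symmetric_family_def k)
  qed
  note H = fam[of h hdual, OF h(1,2)] and H' = fam[of h' hdual', OF h'(1,2)]
  have "\<forall>i\<le>k. \<exists>xs. represents (?H i) xs"
    using H quotient_basis_represents_exists[OF subspace_coboundaries] unfolding cohomology_basis_def
    by (metis le_SucI)
  then obtain ht where ht: "\<forall>i\<le>k. represents (?H i) (ht i)" by metis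
  have "\<forall>i\<le>k. \<exists>xs. represents (?H' i) xs"
    using H' quotient_basis_represents_exists[OF subspace_coboundaries] unfolding cohomology_basis_def
    by (metis le_SucI)
  then obtain ht' where ht': "\<forall>i\<le>k. represents (?H' i) (ht' i)" by metis
  have sub: "subspace (?Z i)" "subspace (?B i)" "?B i \<subseteq> ?Z i" if "i \<le> k" for i
    using that subspace_cocycles subspace_coboundaries coboundaries_subset_cocycles by auto
  have bas: "basis_mod scale (?Z i) (?B i) (ht i)" "?H i = map (qclass (?B i)) (ht i)" if i: "i \<le> k" for i
    using quotient_basis_represents[OF sub(2,1,3)[OF i]] H ht i unfolding cohomology_basis_def by auto
  have bas': "basis_mod scale (?Z i) (?B i) (ht' i)" "?H' i = map (qclass (?B i)) (ht' i)" if i: "i \<le> k" for i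
    using quotient_basis_represents[OF sub(2,1,3)[OF i]] H' ht' i unfolding cohomology_basis_def by auto
  have "\<exists>A. transition scale (?B i) (ht i) (ht' i) A" if i: "i \<le> k" for i
  proof -
    have "set (ht' i) \<subseteq> ?Z i" using bas'(1)[OF i] by (simp add: basis_mod_def)
    moreover have "length (ht' i) = length (ht i)"
      by (rule basis_mod_length_eq[OF sub(2)[OF i] bas(1)[OF i] bas'(1)[OF i]])
    ultimately show ?thesis using transition_exists[OF bas(1)[OF i]] by metis
  qed
  then obtain A where A: "\<forall>i\<le>k. transition scale (?B i) (ht i) (ht' i) (A i)" by metis
  show "torsion scale k C \<delta> c ?H \<noteq> 0"
    by (rule torsion_change(2)[OF H H' ht ht' A])
  have norm: "Determinant.det (A j) powi ((-1) ^ Suc j) * Determinant.det (A (k - j)) powi ((-1) ^ Suc (k - j))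
      \<in> norm_set \<iota>" if j: "j \<le> m" for j
  proof -
    have jk: "j \<le> k" "k - j \<le> k" "\<not> k - j \<le> m" "k - (k - j) = j" using j by (auto simp: k)
    have fam: "h j = map (qclass (?B j)) (ht j)" "h' j = map (qclass (?B j)) (ht' j)"
      "hdual j = map (qclass (?B (k - j))) (ht (k - j))" "hdual' j = map (qclass (?B (k - j))) (ht' (k - j))"
      using bas(2)[OF jk(1)] bas(2)[OF jk(2)] bas'(2)[OF jk(1)] bas'(2)[OF jk(2)] j jk(3,4)
      by (auto simp: symmetric_family_def k)
    have "\<iota> (Determinant.det (A j)) * Determinant.det (A (k - j)) = 1"
    proof (rule sesquilinear_pairing_det[OF \<iota> P[OF j]])
      show "set (ht j) \<subseteq> ?Z j" "set (ht (k - j)) \<subseteq> ?Z (k - j)"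
        using bas(1)[OF jk(1)] bas(1)[OF jk(2)] by (auto simp: basis_mod_def)
      show "transition scale (?B j) (ht j) (ht' j) (A j)"
        "transition scale (?B (k - j)) (ht (k - j)) (ht' (k - j)) (A (k - j))"
        using A jk by auto
      show "dual_classes (P j) (map (qclass (?B j)) (ht j)) (map (qclass (?B (k - j))) (ht (k - j)))"
        "dual_classes (P j) (map (qclass (?B j)) (ht' j)) (map (qclass (?B (k - j))) (ht' (k - j)))"
        using h(3)[OF j] h'(3)[OF j] fam by auto
    qed (use sub jk in auto)
    then have "Determinant.det (A j) powi ((-1) ^ Suc j) * Determinant.det (A (k - j)) powi (- ((-1) ^ Suc j))
      \<in> norm_set \<iota>"
      by (rule dual_det_quotient_in_norm_set[OF \<iota>])
    moreover have "(-1::int) ^ Suc (k - j) = - ((-1) ^ Suc j)"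
    proof -
      have "Suc (k - j) + Suc j = 2 * m + 3" using j by (simp add: k)
      then have "odd (Suc (k - j) + Suc j)" by simp
      then show ?thesis by (cases "even j") (auto simp del: power_Suc simp: uminus_power_if)
    qed
    ultimately show ?thesis by (simp del: power_Suc)
  qed
  have "torsion scale k C \<delta> c ?H' = torsion scale k C \<delta> c ?H *
      (\<Prod>i\<le>k. Determinant.det (A i) powi ((-1) ^ Suc i))"
    by (rule torsion_change(1)[OF H H' ht ht' A])
  moreover have "(\<Prod>i\<le>k. Determinant.det (A i) powi ((-1) ^ Suc i)) \<in> norm_set \<iota>"
    unfolding k prod_pair_complementary using norm by (intro norm_set_prod[OF \<iota>]) (auto simp: k)
  ultimately show "\<exists>y\<in>norm_set \<iota>. torsion scale k C \<delta> c ?H' = torsion scale k C \<delta> c ?H * y"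
    by blast
qed

end

section \<open>The complex of equivariant cellular cochains\<close>

lemma cell_boundary_hom:
  assumes "F (Suc i) \<subseteq> F (Suc (Suc i))"
  shows "cell_boundary F i \<in> hom (cell_group F (Suc i)) (cell_group F i)"
  using group_homomorphism_hom_relboundary[of "int (Suc i)" "top_of_set (F (Suc (Suc i)))" "F (Suc i)" "F i"] assms
  by (simp add: cell_boundary_def cell_group_def subtopology_subtopology Int_absorb1)

lemma cell_boundary_carrier:
  assumes "F (Suc i) \<subseteq> F (Suc (Suc i))"
  shows "cell_boundary F i c \<in> carrier (cell_group F i)"
  using hom_relboundary[of "int (Suc i)" "top_of_set (F (Suc (Suc i)))" "F (Suc i)" "F i" c] assms
  by (simp add: cell_boundary_def cell_group_def subtopology_subtopology Int_absorb1)

text \<open>The composite contains two consecutive maps of the long exact sequence of the pair formed by the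
  two middle stages of the filtration.\<close>

lemma cell_boundary_boundary:
  assumes mono: "mono F"
  shows "cell_boundary F i (cell_boundary F (Suc i) c) = \<one>\<^bsub>cell_group F i\<^esub>"
proof -
  have F: "F (Suc i) \<subseteq> F (Suc (Suc i))" "F (Suc (Suc i)) \<subseteq> F (Suc (Suc (Suc i)))"
    using mono by (auto simp: mono_iff_le_Suc)
  let ?T = "top_of_set (F (Suc (Suc i)))" and ?S = "top_of_set (F (Suc i))"
  have sub: "subtopology ?T (F (Suc i)) = ?S"
    "subtopology (top_of_set (F (Suc (Suc (Suc i))))) (F (Suc (Suc i))) = ?T"
    using F by (auto simp: subtopology_subtopology Int_absorb1)
  define x where "x = hom_boundary (int (Suc (Suc i))) (top_of_set (F (Suc (Suc (Suc i))))) (F (Suc (Suc i))) c"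
  have x: "x \<in> carrier (homology_group (int (Suc i)) ?T)"
    using hom_boundary_carrier[of "int (Suc (Suc i))" "top_of_set (F (Suc (Suc (Suc i))))" "F (Suc (Suc i))" c] sub
    by (simp add: x_def)
  have bx: "cell_boundary F (Suc i) c = hom_induced (int (Suc i)) ?T {} ?T (F (Suc i)) id x"
    using sub by (simp add: cell_boundary_def hom_relboundary_def x_def)
  have "hom_boundary (int (Suc i)) ?T (F (Suc i)) (hom_induced (int (Suc i)) ?T {} ?T (F (Suc i)) id x)
      = \<one>\<^bsub>homology_group (int i) ?S\<^esub>"
    using homology_exactness_axiom_1[of "int (Suc i)" ?T "F (Suc i)"] x sub
    by (auto simp: kernel_def)
  then have "cell_boundary F i (cell_boundary F (Suc i) c) =
      hom_induced (int i) ?S {} ?S (F i) id \<one>\<^bsub>homology_group (int i) ?S\<^esub>"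
    unfolding bx by (simp add: cell_boundary_def hom_relboundary_def sub)
  also have "\<dots> = \<one>\<^bsub>cell_group F i\<^esub>"
    unfolding cell_group_def
    by (rule hom_one[OF hom_induced_hom]) auto
  finally show ?thesis .
qed

text \<open>Naturality of the connecting homomorphism; it makes coboundaries of equivariant cochains
  equivariant.\<close>

lemma cell_boundary_cell_map:
  assumes mono: "mono F" and f: "continuous_on (F (Suc (Suc i))) f" "\<And>j. f ` F j \<subseteq> F j"
  shows "cell_boundary F i (cell_map F f (Suc i) c) = cell_map F f i (cell_boundary F i c)"
proof -
  have F: "F (Suc i) \<subseteq> F (Suc (Suc i))"
    using mono by (auto simp: mono_iff_le_Suc)
  have sub: "subtopology (top_of_set (F (Suc (Suc i)))) (F (Suc i)) = top_of_set (F (Suc i))"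
    using F by (auto simp: subtopology_subtopology Int_absorb1)
  have "continuous_map (top_of_set (F (Suc (Suc i)))) (top_of_set (F (Suc (Suc i)))) f"
    using f by (auto simp: continuous_map_subtopology_eu)
  from naturality_hom_induced_relboundary[OF this, of "F (Suc i)" "F (Suc i)" "F i" "F i" "int (Suc i)"] f(2)
  have "hom_relboundary (int (Suc i)) (top_of_set (F (Suc (Suc i)))) (F (Suc i)) (F i) \<circ>
      hom_induced (int (Suc i)) (top_of_set (F (Suc (Suc i)))) (F (Suc i)) (top_of_set (F (Suc (Suc i)))) (F (Suc i)) f =
      hom_induced (int i) (top_of_set (F (Suc i))) (F i) (top_of_set (F (Suc i))) (F i) f \<circ>
      hom_relboundary (int (Suc i)) (top_of_set (F (Suc (Suc i)))) (F (Suc i)) (F i)"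
    by (auto simp: sub image_subset_iff_funcset)
  then show ?thesis
    unfolding cell_boundary_def cell_map_def by (simp add: fun_eq_iff)
qed

lemma group_cell_group: "group (cell_group F i)"
  by (simp add: cell_group_def)

lemma cell_cochain_one:
  assumes "\<phi> \<in> cell_cochains F G act R i"
  shows "\<phi> \<one>\<^bsub>cell_group F i\<^esub> = 0"
proof -
  interpret group "cell_group F i" by (rule group_cell_group)
  have "\<phi> (\<one>\<^bsub>cell_group F i\<^esub> \<otimes>\<^bsub>cell_group F i\<^esub> \<one>\<^bsub>cell_group F i\<^esub>) =
      \<phi> \<one>\<^bsub>cell_group F i\<^esub> + \<phi> \<one>\<^bsub>cell_group F i\<^esub>"
    using assms one_closed unfolding cell_cochains_def by blast
  then show ?thesis by simp
qed

lemma cell_coboundary_in_cochains: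
  assumes mono: "mono F" and act: "\<And>g j. g \<in> G \<Longrightarrow> continuous_on (F j) (act g) \<and> act g ` F j \<subseteq> F j"
    and \<phi>: "\<phi> \<in> cell_cochains F G act R i"
  shows "cell_coboundary F i \<phi> \<in> cell_cochains F G act R (Suc i)"
proof -
  have F: "F (Suc i) \<subseteq> F (Suc (Suc i))"
    using mono by (auto simp: mono_iff_le_Suc)
  interpret G: group "cell_group F (Suc i)" by (rule group_cell_group)
  note bc = cell_boundary_carrier[of F i, OF F]
  have "cell_map F (act g) (Suc i) c \<in> carrier (cell_group F (Suc i))" for g c
    unfolding cell_map_def cell_group_def by (rule hom_induced_carrier)
  moreover have "cell_boundary F i (cell_map F (act g) (Suc i) c) = cell_map F (act g) i (cell_boundary F i c)"
    if "g \<in> G" for g c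
    using act that by (intro cell_boundary_cell_map mono) auto
  moreover have "cell_boundary F i (c \<otimes>\<^bsub>cell_group F (Suc i)\<^esub> c') =
      cell_boundary F i c \<otimes>\<^bsub>cell_group F i\<^esub> cell_boundary F i c'"
    if "c \<in> carrier (cell_group F (Suc i))" "c' \<in> carrier (cell_group F (Suc i))" for c c'
    using hom_mult[OF cell_boundary_hom[of F i, OF F] that] .
  ultimately show ?thesis
    using \<phi> bc by (simp add: cell_cochains_def cell_coboundary_def)
qed

lemma cell_coboundary_coboundary:
  assumes mono: "mono F" and \<phi>: "\<phi> \<in> cell_cochains F G act R i"
  shows "cell_coboundary F (Suc i) (cell_coboundary F i \<phi>) = 0"
proof
  have F: "F (Suc (Suc i)) \<subseteq> F (Suc (Suc (Suc i)))"
    using mono by (auto simp: mono_iff_le_Suc)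
  show "cell_coboundary F (Suc i) (cell_coboundary F i \<phi>) c = 0 c" for c
    using cell_boundary_carrier[of F "Suc i", OF F] cell_cochain_one[OF \<phi>]
    by (simp add: cell_coboundary_def cell_boundary_boundary[OF mono])
qed

text \<open>When the filtration is stationary, the next cellular chain group is a homology group of a space
  relative to itself, hence trivial.\<close>

lemma cell_coboundary_top:
  assumes top: "F (Suc (Suc i)) = F (Suc i)" and \<phi>: "\<phi> \<in> cell_cochains F G act R i"
  shows "cell_coboundary F i \<phi> = 0"
proof
  fix c
  have "trivial_group (cell_group F (Suc i))"
    using trivial_relative_homology_group_topspace[of "int (Suc i)" "top_of_set (F (Suc i))"] top
    by (simp add: cell_group_def)
  then have "carrier (cell_group F (Suc i)) = {\<one>\<^bsub>cell_group F (Suc i)\<^esub>}"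
    by (simp add: trivial_group_def)
  moreover have "cell_boundary F i \<one>\<^bsub>cell_group F (Suc i)\<^esub> = \<one>\<^bsub>cell_group F i\<^esub>"
    by (rule hom_one[OF cell_boundary_hom group_cell_group group_cell_group]) (simp add: top)
  ultimately show "cell_coboundary F i \<phi> c = 0 c"
    using cell_cochain_one[OF \<phi>] by (auto simp: cell_coboundary_def)
qed

lemma cell_coboundary_add: "cell_coboundary F i (\<phi> + \<eta>) = cell_coboundary F i \<phi> + cell_coboundary F i \<eta>"
  by (auto simp: cell_coboundary_def fun_eq_iff)

lemma mono_lifted_skel: "mono (lifted_skel Xt p cells)"
proof -
  have "skel cells k \<subseteq> skel cells (Suc k)" for k
    unfolding skel_def by (intro UN_mono) auto
  then show ?thesis
    unfolding mono_iff_le_Suc lifted_skel_def by blast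
qed

lemma lifted_skel_top:
  assumes "finite_CW d X cells"
  shows "lifted_skel Xt p cells (Suc (Suc d)) = lifted_skel Xt p cells (Suc d)"
proof -
  have "cells (Suc d) = []" using assms by (simp add: finite_CW_def)
  then have "skel cells (Suc (Suc d)) = skel cells (Suc d)"
    unfolding skel_def lessThan_Suc[of "Suc d"] by simp
  then show ?thesis by (simp add: lifted_skel_def)
qed

lemma deck_action_lifted_skel:
  assumes "deck_action X Xt p xt act" "g \<in> carrier (pi1 X (p xt))"
  shows "continuous_on (lifted_skel Xt p cells j) (act g)"
    and "act g ` lifted_skel Xt p cells j \<subseteq> lifted_skel Xt p cells j"
proof -
  have *: "(\<exists>f. homeomorphism Xt Xt (act g) f) \<and> (\<forall>y\<in>Xt. p (act g y) = p y)"
    using bspec[OF assms(1)[unfolded deck_action_def] assms(2)] by (elim conjE) (intro conjI)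
  then obtain f where f: "homeomorphism Xt Xt (act g) f" by (elim conjE exE)
  have p: "p (act g y) = p y" if "y \<in> Xt" for y using * that by blast
  have "continuous_on Xt (act g)" "act g ` Xt = Xt"
    using f by (auto simp: homeomorphism_def)
  then show "continuous_on (lifted_skel Xt p cells j) (act g)"
    "act g ` lifted_skel Xt p cells j \<subseteq> lifted_skel Xt p cells j"
    using p by (auto simp: lifted_skel_def intro: continuous_on_subset)
qed

lemma vector_space_fun_scale:
  assumes "vector_space s" shows "vector_space (fun_scale s)"
proof -
  interpret vector_space s by fact
  show ?thesis
    by unfold_locales (auto simp: fun_scale_def fun_eq_iff scale_right_distrib scale_left_distrib)
qed

lemma based_complex_twisted_cochains:
  fixes c :: "nat \<Rightarrow> ('c::topological_space chain set \<Rightarrow> 'f::field ^ 'n::finite) list"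
  assumes deck: "deck_action X Xt p xt act" and CW: "finite_CW d X cells"
    and c: "\<And>i. i \<le> d \<Longrightarrow> ordered_basis (fun_scale (*s)) (twisted_cochains X Xt p xt act \<rho> cells i) (c i)"
  shows "based_complex (fun_scale (*s)) d (twisted_cochains X Xt p xt act \<rho> cells)
    (cell_coboundary (lifted_skel Xt p cells)) c"
proof -
  have "vector_space ((*s) :: 'f \<Rightarrow> 'f ^ 'n \<Rightarrow> 'f ^ 'n)" by unfold_locales
  then interpret vector_space "fun_scale (*s) :: 'f \<Rightarrow> ('c chain set \<Rightarrow> 'f ^ 'n) \<Rightarrow> _"
    by (rule vector_space_fun_scale)
  show ?thesis
  proof (intro based_complex.intro based_complex_axioms.intro vector_space_axioms)
    fix i a and \<phi> \<eta> :: "'c chain set \<Rightarrow> 'f ^ 'n"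
    show "cell_coboundary (lifted_skel Xt p cells) i (\<phi> + \<eta>) =
        cell_coboundary (lifted_skel Xt p cells) i \<phi> + cell_coboundary (lifted_skel Xt p cells) i \<eta>"
      by (rule cell_coboundary_add)
    show "cell_coboundary (lifted_skel Xt p cells) i (fun_scale (*s) a \<phi>) =
        fun_scale (*s) a (cell_coboundary (lifted_skel Xt p cells) i \<phi>)"
      by (auto simp: cell_coboundary_def fun_scale_def)
    assume "\<phi> \<in> twisted_cochains X Xt p xt act \<rho> cells i"
    then have \<phi>: "\<phi> \<in> cell_cochains (lifted_skel Xt p cells) (carrier (pi1 X (p xt))) act (\<lambda>g v. \<rho> g *v v) i"
      by (simp add: twisted_cochains_def)
    show "cell_coboundary (lifted_skel Xt p cells) i \<phi> \<in> twisted_cochains X Xt p xt act \<rho> cells (Suc i)"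
      unfolding twisted_cochains_def using deck_action_lifted_skel[OF deck]
      by (intro cell_coboundary_in_cochains mono_lifted_skel \<phi>) blast
    show "cell_coboundary (lifted_skel Xt p cells) (Suc i) (cell_coboundary (lifted_skel Xt p cells) i \<phi>) = 0"
      by (rule cell_coboundary_coboundary[OF mono_lifted_skel \<phi>])
  next
    fix \<phi> assume "\<phi> \<in> twisted_cochains X Xt p xt act \<rho> cells d"
    then show "cell_coboundary (lifted_skel Xt p cells) d \<phi> = 0"
      unfolding twisted_cochains_def by (rule cell_coboundary_top[where F = "lifted_skel Xt p cells", OF lifted_skel_top[OF CW]])
  qed (rule c)
qed

section \<open>Independence of the refined torsion of the bases\<close>

lemma comm_group_field_units: "comm_group (field_units :: 'f::field monoid)"
proof (rule comm_groupI)
  fix x :: 'f assume "x \<in> carrier field_units"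
  then show "\<exists>y\<in>carrier field_units. y \<otimes>\<^bsub>field_units\<^esub> x = \<one>\<^bsub>field_units\<^esub>"
    by (intro bexI[of _ "inverse x"]) (auto simp: field_units_def)
qed (auto simp: field_units_def)

lemma torsion_subgroup_subgroup:
  assumes \<iota>: "field_involution \<iota>" and \<rho>: "\<rho> \<in> hom (pi1 X x) GL"
  shows "subgroup (torsion_subgroup \<iota> X x \<rho>) field_units"
  unfolding torsion_subgroup_def
proof (rule group.generate_is_subgroup)
  show "group (field_units :: 'a monoid)" using comm_group_field_units by (rule comm_group.axioms(2))
  have "y * \<iota> y \<noteq> 0" if "y \<noteq> 0" for y
  proof -
    have "\<iota> (y * inverse y) = \<iota> y * \<iota> (inverse y)" "\<iota> 1 = 1" using \<iota> by (auto simp: field_involution_def)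
    then have "\<iota> y \<noteq> 0" using that by auto
    then show ?thesis using that by simp
  qed
  moreover have "Determinants.det (\<rho> g) \<noteq> 0" if "g \<in> carrier (pi1 X x)" for g
    using \<rho> that invertible_det_nz[of "\<rho> g"] by (auto simp: hom_def GL_def)
  ultimately show "norm_set \<iota> \<union> det_image X x \<rho> \<subseteq> carrier field_units"
    by (auto simp: field_units_def norm_set_def det_image_def)
qed

lemma norm_set_subset_torsion_subgroup: "norm_set \<iota> \<subseteq> torsion_subgroup \<iota> X x \<rho>"
  unfolding torsion_subgroup_def by (auto intro: generate.incl)

text \<open>The quotient of the two torsions is a norm, and norms lie in the subgroup whose cosets are compared.\<close>
theorem theorem3p1:
  fixes X :: "'a::topological_space set"
    and atlas :: "('a set \<times> ('a \<Rightarrow> 'e::euclidean_space)) set"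
    and Xt :: "'c::topological_space set" and p :: "'c \<Rightarrow> 'a" and xt :: 'c
    and act :: "(real \<Rightarrow> 'a) set \<Rightarrow> 'c \<Rightarrow> 'c"
    and \<iota> :: "'f::field \<Rightarrow> 'f"
    and \<rho> :: "(real \<Rightarrow> 'a) set \<Rightarrow> 'f ^ 'n::{finite,linorder} ^ 'n::{finite,linorder}"
    and \<psi> :: "'f ^ 'n::{finite,linorder} \<Rightarrow> 'f ^ 'n::{finite,linorder} \<Rightarrow> 'f"
    and m :: nat and \<mu> :: "'a \<Rightarrow> 'a chain set" and \<zeta> :: "'a chain set"
    and cells :: "nat \<Rightarrow> 'a simp list" and lifts :: "nat \<Rightarrow> 'c simp list"
    and c :: "nat \<Rightarrow> ('c chain set \<Rightarrow> 'f ^ 'n::{finite,linorder}) list"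
    and cR :: "nat \<Rightarrow> ('a chain set \<Rightarrow> real) list"
    and hR :: "nat \<Rightarrow> ('a chain set \<Rightarrow> real) set list"
    and h h' hdual hdual' :: "nat \<Rightarrow> ('c chain set \<Rightarrow> 'f ^ 'n::{finite,linorder}) set list"
  defines "d \<equiv> 2 * m + 1"
    and "F \<equiv> lifted_skel Xt p cells"
    and "C \<equiv> twisted_cochains X Xt p xt act \<rho> cells"
    and "\<delta> \<equiv> cell_coboundary (lifted_skel Xt p cells)"
    and "pairing \<equiv> cup_pairing X Xt p xt act \<rho> cells \<zeta> \<psi>"
  assumes manifold: "smooth_manifold X atlas" "DIM('e) = d" "compact X" "connected X"
    and orientation: "manifold_orientation d X \<mu>" "fundamental_class d X \<mu> \<zeta>"
    and cover: "universal_cover Xt p X" "xt \<in> Xt" "deck_action X Xt p xt act"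
    and involution: "field_involution \<iota>"
    and representation: "\<rho> \<in> hom (pi1 X (p xt)) GL"
    and form: "sesquilinear_form \<iota> \<psi>" "hermitian \<iota> \<psi> \<or> antihermitian \<iota> \<psi>"
    and invariant: "\<And>g v w. g \<in> carrier (pi1 X (p xt)) \<Longrightarrow> \<psi> (\<rho> g *v v) (\<rho> g *v w) = \<psi> v w"
    and CW: "finite_CW d X cells" "cell_lifts Xt p cells lifts"
    and cellular_basis: "\<And>i. i \<le> d \<Longrightarrow> dual_cell_basis (*s) F i (C i) (lifts i) standard_basis (c i)"
    and real_cellular_basis:
      "\<And>i. i \<le> d \<Longrightarrow> dual_cell_basis (*) (skel cells) i (real_cochains cells i) (cells i) [1] (cR i)"
    and real_cohomology_basis:
      "\<And>i. i \<le> d \<Longrightarrow>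
        cohomology_basis (fun_scale (*)) (real_cochains cells) (cell_coboundary (skel cells)) i (hR i)"
    and nondegenerate:
      "\<And>i. i \<le> d \<Longrightarrow> nondegenerate_pairing (fun_scale (*s)) \<iota>
        (cocycles C \<delta> i) (coboundaries C \<delta> i) (cocycles C \<delta> (d - i)) (coboundaries C \<delta> (d - i))
        (pairing i (d - i))"
    and bases:
      "\<And>j. j \<le> m \<Longrightarrow> cohomology_basis (fun_scale (*s)) C \<delta> j (h j)"
      "\<And>j. j \<le> m \<Longrightarrow> cohomology_basis (fun_scale (*s)) C \<delta> (d - j) (hdual j)"
      "\<And>j. j \<le> m \<Longrightarrow> dual_classes (pairing j (d - j)) (h j) (hdual j)"
    and bases':
      "\<And>j. j \<le> m \<Longrightarrow> cohomology_basis (fun_scale (*s)) C \<delta> j (h' j)"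
      "\<And>j. j \<le> m \<Longrightarrow> cohomology_basis (fun_scale (*s)) C \<delta> (d - j) (hdual' j)"
      "\<And>j. j \<le> m \<Longrightarrow> dual_classes (pairing j (d - j)) (h' j) (hdual' j)"
  shows "refined_torsion \<iota> d X Xt p xt act \<rho> cells cR hR c (symmetric_family m h hdual)
           \<in> carrier (field_units Mod torsion_subgroup \<iota> X (p xt) \<rho>) \<and>
         refined_torsion \<iota> d X Xt p xt act \<rho> cells cR hR c (symmetric_family m h hdual) =
         refined_torsion \<iota> d X Xt p xt act \<rho> cells cR hR c (symmetric_family m h' hdual')"
proof -
  interpret based_complex "fun_scale (*s)" d C \<delta> c
    unfolding C_def \<delta>_def
  proof (rule based_complex_twisted_cochains[OF cover(3) CW(1)])
    fix i assume "i \<le> d"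
    then show "ordered_basis (fun_scale (*s)) (twisted_cochains X Xt p xt act \<rho> cells i) (c i)"
      using cellular_basis[of i] by (simp add: dual_cell_basis_def C_def)
  qed
  let ?t = "torsion (fun_scale (*s)) d C \<delta> c (symmetric_family m h hdual)"
  let ?t' = "torsion (fun_scale (*s)) d C \<delta> c (symmetric_family m h' hdual')"
  have pairing: "sesquilinear_pairing (fun_scale (*s)) \<iota> (cocycles C \<delta> j) (coboundaries C \<delta> j)
      (cocycles C \<delta> (d - j)) (coboundaries C \<delta> (d - j)) (pairing j (d - j))" if "j \<le> m" for j
  proof -
    have "j \<le> d" using that by (simp add: d_def)
    from nondegenerate[OF this] show ?thesis unfolding nondegenerate_pairing_def by (rule conjunct1)
  qed
  have t: "?t \<noteq> 0" and t': "\<exists>y\<in>norm_set \<iota>. ?t' = ?t * y"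
    by (rule torsion_symmetric_family_norm[where P = "\<lambda>j. pairing j (d - j)",
          OF meta_eq_to_obj_eq[OF d_def] involution pairing bases bases']; assumption)+
  from t' obtain y where y: "y \<in> norm_set \<iota>" "?t' = ?t * y" by blast
  \<comment> \<open>The sign depends on the real cohomology only, so it is common to both families of bases.\<close>
  define \<epsilon> :: 'f where "\<epsilon> = (if tau_tilde d cells cR hR < 0 then -1 else 1) ^ CARD('n)"
  have \<epsilon>: "\<epsilon> \<noteq> 0" by (simp add: \<epsilon>_def)
  let ?T = "torsion_subgroup \<iota> X (p xt) \<rho>"
  interpret units: comm_group "field_units :: 'f monoid" by (rule comm_group_field_units)
  have T: "subgroup ?T field_units" by (rule torsion_subgroup_subgroup[OF involution representation])
  have rep: "refined_torsion \<iota> d X Xt p xt act \<rho> cells cR hR c H =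
      ?T #>\<^bsub>field_units\<^esub> (\<epsilon> * torsion (fun_scale (*s)) d C \<delta> c H)" for H
    by (simp add: refined_torsion_def refined_torsion_rep_def \<epsilon>_def C_def \<delta>_def)
  have carr: "\<epsilon> * ?t \<in> carrier field_units" using t \<epsilon> by (simp add: field_units_def)
  have "\<epsilon> * ?t' = y \<otimes>\<^bsub>field_units\<^esub> (\<epsilon> * ?t)" using y(2) by (simp add: field_units_def)
  then have "\<epsilon> * ?t' \<in> ?T #>\<^bsub>field_units\<^esub> (\<epsilon> * ?t)"
    using y(1) norm_set_subset_torsion_subgroup[of \<iota> X "p xt" \<rho>] by (auto simp: r_coset_def)
  then have "?T #>\<^bsub>field_units\<^esub> (\<epsilon> * ?t) = ?T #>\<^bsub>field_units\<^esub> (\<epsilon> * ?t')"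
    by (rule units.repr_independence[OF _ carr T])
  moreover have "?T #>\<^bsub>field_units\<^esub> (\<epsilon> * ?t) \<in> carrier (field_units Mod ?T)"
    unfolding FactGroup_def using units.rcosetsI[OF subgroup.subset[OF T] carr] by simp
  ultimately show ?thesis unfolding rep by blast
qed

end
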